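(* Let $G$ be a Lie group with Lie algebra $\mathfrak{g}$ and a left-invariant Riemannian metric $\mathsf{h}$, inducing the inner product $\langle\,,\rangle$ on $\mathfrak{g}$. Let $X\in\mathfrak{g}$ be a non-zero left-invariant vector field with $\|X\|=\sqrt{\langle X,X\rangle}<1$, and let $g_X$ be the left-invariant Riemannian metric on $G$ given on $\mathfrak{g}$ by $$g_X(v,z)=(1+\|X\|)\Big(\langle v,z\rangle+\frac{1}{\|X\|}\langle X,v\rangle\langle X,z\rangle\Big).$$ Let $v\in\mathfrak{g}$, and let $\mathrm{ad}_v^*$ denote the transpose of $\mathrm{ad}_v$ with respect to $\langle\,,\rangle$. \begin{enumerate} \item If $v$ is a geodesic vector field with respect to $\mathsf{h}$, then $v$ is a geodesic vector field with respect to $g_X$ if and only if $\mathrm{ad}_v^*X=0$ or $\langle X,v\rangle=0$. \item If $v$ is a Killing vector field with respect to $\mathsf{h}$, then $v$ is a Killing vector field with respect to $g_X$ if and only if $\mathrm{ad}_v^*X=0$. \end{enumerate}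
   Context: Elements of $\mathfrak{g}$ are identified with left-invariant vector fields on $G$. For a left-invariant Riemannian metric $g$ on $G$, an element $v\in\mathfrak{g}$ is a geodesic vector (field) with respect to $g$ if and only if $g(v,[v,y])=0$ for all $y\in\mathfrak{g}$. The left-invariant vector field $v$ is a Killing vector field of $g$ if and only if $g([v,y],z)+g(y,[v,z])=0$ for all $y,z\in\mathfrak{g}$. *)

theory Defs
  imports "HOL-Analysis.Analysis" "HOL-Algebra.Group"
begin

section \<open>Smooth functions on open sets\<close>

text \<open>
  Continuous differentiability of order \<open>k\<close>, by recursion over directional derivatives. The set
  \<open>S\<close> is meant to be open. Since the domain is finite-dimensional wherever this is used,
  continuity of all directional derivatives up to order \<open>k\<close> is the usual notion of \<open>C^k\<close>.
\<close>

primrec Ck_on :: "nat \<Rightarrow> 'a::real_normed_vector set \<Rightarrow> ('a \<Rightarrow> 'b::real_normed_vector) \<Rightarrow> bool"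
  where
    "Ck_on 0 S f \<longleftrightarrow> continuous_on S f"
  | "Ck_on (Suc k) S f \<longleftrightarrow>
       f differentiable_on S \<and> (\<forall>v. Ck_on k S (\<lambda>x. frechet_derivative f (at x) v))"

definition smooth_on :: "'a::real_normed_vector set \<Rightarrow> ('a \<Rightarrow> 'b::real_normed_vector) \<Rightarrow> bool"
  where "smooth_on S f \<longleftrightarrow> (\<forall>k. Ck_on k S f)"

section \<open>Smooth manifolds\<close>

text \<open>
  A manifold is a topology \<open>T\<close> together with a (not necessarily maximal) smooth atlas \<open>A\<close>
  modelled on a Euclidean space. A chart is its domain paired with its coordinate map; the
  coordinate map is irrelevant outside the domain.
\<close>

type_synonym ('a, 'e) chart = "'a set \<times> ('a \<Rightarrow> 'e)"

definition smooth_atlas :: "'a topology \<Rightarrow> ('a, 'e::euclidean_space) chart set \<Rightarrow> bool"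
  where "smooth_atlas T A \<longleftrightarrow>
    (\<Union>(fst ` A)) = topspace T \<and>
    (\<forall>(U, \<phi>)\<in>A. openin T U \<and> open (\<phi> ` U) \<and>
        homeomorphic_map (subtopology T U) (top_of_set (\<phi> ` U)) \<phi>) \<and>
    (\<forall>(U, \<phi>)\<in>A. \<forall>(V, \<psi>)\<in>A. smooth_on (\<phi> ` (U \<inter> V)) (\<psi> \<circ> inv_into U \<phi>))"

definition smooth_manifold :: "'a topology \<Rightarrow> ('a, 'e::euclidean_space) chart set \<Rightarrow> bool"
  where "smooth_manifold T A \<longleftrightarrow>
    Hausdorff_space T \<and> second_countable T \<and> smooth_atlas T A"

definition prod_atlas ::
    "('a, 'e) chart set \<Rightarrow> ('b, 'f) chart set \<Rightarrow> ('a \<times> 'b, 'e \<times> 'f) chart set"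
  where "prod_atlas A B = {(U \<times> V, map_prod \<phi> \<psi>) | U \<phi> V \<psi>. (U, \<phi>) \<in> A \<and> (V, \<psi>) \<in> B}"

definition smooth_map ::
    "'a topology \<Rightarrow> ('a, 'e::euclidean_space) chart set \<Rightarrow>
     'b topology \<Rightarrow> ('b, 'f::euclidean_space) chart set \<Rightarrow> ('a \<Rightarrow> 'b) \<Rightarrow> bool"
  where "smooth_map T A T' B f \<longleftrightarrow>
    continuous_map T T' f \<and>
    (\<forall>(U, \<phi>)\<in>A. \<forall>(V, \<psi>)\<in>B. smooth_on (\<phi> ` {x \<in> U. f x \<in> V}) (\<psi> \<circ> f \<circ> inv_into U \<phi>))"

text \<open>Smoothness of a real function on the open set \<open>S\<close>, and on some neighbourhood of a point.\<close>

definition smooth_fun_on ::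
    "('a, 'e::euclidean_space) chart set \<Rightarrow> 'a set \<Rightarrow> ('a \<Rightarrow> real) \<Rightarrow> bool"
  where "smooth_fun_on A S f \<longleftrightarrow> (\<forall>(U, \<phi>)\<in>A. smooth_on (\<phi> ` (U \<inter> S)) (f \<circ> inv_into U \<phi>))"

definition smooth_near ::
    "'a topology \<Rightarrow> ('a, 'e::euclidean_space) chart set \<Rightarrow> 'a \<Rightarrow> ('a \<Rightarrow> real) \<Rightarrow> bool"
  where "smooth_near T A p f \<longleftrightarrow> (\<exists>S. openin T S \<and> p \<in> S \<and> smooth_fun_on A S f)"

section \<open>Tangent vectors and vector fields\<close>

text \<open>
  A tangent vector at \<open>p\<close> is a derivation of the algebra of germs at \<open>p\<close> of smooth functions.
  It is encoded as a functional on all real functions, with the value \<open>0\<close> on functions that are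
  not smooth near \<open>p\<close>; equality of tangent vectors is thus equality of functionals.
\<close>

type_synonym 'a tangent = "('a \<Rightarrow> real) \<Rightarrow> real"

definition tangent_space ::
    "'a topology \<Rightarrow> ('a, 'e::euclidean_space) chart set \<Rightarrow> 'a \<Rightarrow> 'a tangent set"
  where "tangent_space T A p = {t.
    (\<forall>f g. smooth_near T A p f \<longrightarrow> smooth_near T A p g \<longrightarrow>
        t (\<lambda>x. f x + g x) = t f + t g \<and>
        t (\<lambda>x. f x * g x) = t f * g p + f p * t g) \<and>
    (\<forall>c f. smooth_near T A p f \<longrightarrow> t (\<lambda>x. c * f x) = c * t f) \<and>
    (\<forall>f g. smooth_near T A p f \<longrightarrow> smooth_near T A p g \<longrightarrow>
        (\<exists>S. openin T S \<and> p \<in> S \<and> (\<forall>x\<in>S. f x = g x)) \<longrightarrow> t f = t g) \<and>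
    (\<forall>f. \<not> smooth_near T A p f \<longrightarrow> t f = 0)}"

definition smooth_vector_field_on ::
    "'a topology \<Rightarrow> ('a, 'e::euclidean_space) chart set \<Rightarrow> 'a set \<Rightarrow> ('a \<Rightarrow> 'a tangent) \<Rightarrow> bool"
  where "smooth_vector_field_on T A S V \<longleftrightarrow>
    (\<forall>p\<in>S. V p \<in> tangent_space T A p) \<and>
    (\<forall>U f. openin T U \<longrightarrow> U \<subseteq> S \<longrightarrow> smooth_fun_on A U f \<longrightarrow> smooth_fun_on A U (\<lambda>p. V p f))"

text \<open>Global smooth vector fields, extended by zero off the manifold to be determined by it.\<close>

definition vector_fields ::
    "'a topology \<Rightarrow> ('a, 'e::euclidean_space) chart set \<Rightarrow> ('a \<Rightarrow> 'a tangent) set"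
  where "vector_fields T A = {V. smooth_vector_field_on T A (topspace T) V \<and>
    (\<forall>p. p \<notin> topspace T \<longrightarrow> V p = (\<lambda>f. 0))}"

definition lie_bracket ::
    "'a topology \<Rightarrow> ('a, 'e::euclidean_space) chart set \<Rightarrow>
     ('a \<Rightarrow> 'a tangent) \<Rightarrow> ('a \<Rightarrow> 'a tangent) \<Rightarrow> 'a \<Rightarrow> 'a tangent"
  where "lie_bracket T A V W = (\<lambda>p f.
    if smooth_near T A p f then V p (\<lambda>q. W q f) - W p (\<lambda>q. V q f) else 0)"

text \<open>The smooth compatibility condition is tested on smooth local vector fields.\<close>

definition riemannian_metric ::
    "'a topology \<Rightarrow> ('a, 'e::euclidean_space) chart set \<Rightarrow>
     ('a \<Rightarrow> 'a tangent \<Rightarrow> 'a tangent \<Rightarrow> real) \<Rightarrow> bool"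
  where "riemannian_metric T A h \<longleftrightarrow>
    (\<forall>p\<in>topspace T. \<forall>r\<in>tangent_space T A p. \<forall>s\<in>tangent_space T A p.
        h p r s = h p s r \<and>
        (\<forall>c. h p (\<lambda>f. c * r f) s = c * h p r s) \<and>
        (\<forall>t\<in>tangent_space T A p. h p (\<lambda>f. r f + s f) t = h p r t + h p s t) \<and>
        (r \<noteq> (\<lambda>f. 0) \<longrightarrow> h p r r > 0)) \<and>
    (\<forall>S V W. openin T S \<longrightarrow> smooth_vector_field_on T A S V \<longrightarrow>
        smooth_vector_field_on T A S W \<longrightarrow> smooth_fun_on A S (\<lambda>p. h p (V p) (W p)))"

section \<open>Lie groups and left-invariance\<close>

locale lie_group = group G
  for G :: "('a, 'b) monoid_scheme" (structure) +
  fixes T :: "'a topology" and A :: "('a, 'e::euclidean_space) chart set"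
  assumes topspace_eq: "topspace T = carrier G"
    and manifold: "smooth_manifold T A"
    and smooth_mult: "smooth_map (prod_topology T T) (prod_atlas A A) T A (\<lambda>(x, y). x \<otimes> y)"
    and smooth_inverse: "smooth_map T A T A (\<lambda>x. inv x)"

text \<open>The differential of left translation by \<open>a\<close>, applied to a tangent vector.\<close>

definition left_push :: "('a, 'b) monoid_scheme \<Rightarrow> 'a \<Rightarrow> 'a tangent \<Rightarrow> 'a tangent"
  where "left_push G a t = (\<lambda>f. t (\<lambda>x. f (a \<otimes>\<^bsub>G\<^esub> x)))"

text \<open>The Lie algebra is the set of left-invariant vector fields, with \<open>lie_bracket\<close>.\<close>

definition lie_algebra ::
    "('a, 'b) monoid_scheme \<Rightarrow> 'a topology \<Rightarrow> ('a, 'e::euclidean_space) chart set \<Rightarrow>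
     ('a \<Rightarrow> 'a tangent) set"
  where "lie_algebra G T A = {V \<in> vector_fields T A.
    \<forall>a\<in>carrier G. \<forall>p\<in>carrier G. V (a \<otimes>\<^bsub>G\<^esub> p) = left_push G a (V p)}"

definition left_invariant_metric ::
    "('a, 'b) monoid_scheme \<Rightarrow> 'a topology \<Rightarrow> ('a, 'e::euclidean_space) chart set \<Rightarrow>
     ('a \<Rightarrow> 'a tangent \<Rightarrow> 'a tangent \<Rightarrow> real) \<Rightarrow> bool"
  where "left_invariant_metric G T A h \<longleftrightarrow> riemannian_metric T A h \<and>
    (\<forall>a\<in>carrier G. \<forall>p\<in>carrier G. \<forall>s\<in>tangent_space T A p. \<forall>t\<in>tangent_space T A p.
        h (a \<otimes>\<^bsub>G\<^esub> p) (left_push G a s) (left_push G a t) = h p s t)"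

text \<open>
  On left-invariant fields a left-invariant metric is constant, so the inner product it induces
  on the Lie algebra may be read off at the identity.
\<close>

definition induced_inner ::
    "('a, 'b) monoid_scheme \<Rightarrow> ('a \<Rightarrow> 'a tangent \<Rightarrow> 'a tangent \<Rightarrow> real) \<Rightarrow>
     ('a \<Rightarrow> 'a tangent) \<Rightarrow> ('a \<Rightarrow> 'a tangent) \<Rightarrow> real"
  where "induced_inner G h v w = h \<one>\<^bsub>G\<^esub> (v \<one>\<^bsub>G\<^esub>) (w \<one>\<^bsub>G\<^esub>)"

definition induced_norm ::
    "('a, 'b) monoid_scheme \<Rightarrow> ('a \<Rightarrow> 'a tangent \<Rightarrow> 'a tangent \<Rightarrow> real) \<Rightarrow>
     ('a \<Rightarrow> 'a tangent) \<Rightarrow> real"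
  where "induced_norm G h v = sqrt (induced_inner G h v v)"

text \<open>
  The transpose of \<open>ad v\<close> with respect to the inner product induced by \<open>h\<close>, at \<open>w\<close>: the
  element of the Lie algebra representing the functional that pairs \<open>w\<close> with \<open>[v, y]\<close>.
\<close>

definition ad_transpose ::
    "('a, 'b) monoid_scheme \<Rightarrow> 'a topology \<Rightarrow> ('a, 'e::euclidean_space) chart set \<Rightarrow>
     ('a \<Rightarrow> 'a tangent \<Rightarrow> 'a tangent \<Rightarrow> real) \<Rightarrow>
     ('a \<Rightarrow> 'a tangent) \<Rightarrow> ('a \<Rightarrow> 'a tangent) \<Rightarrow> 'a \<Rightarrow> 'a tangent"
  where "ad_transpose G T A h v w = (THE u. u \<in> lie_algebra G T A \<and>
    (\<forall>y\<in>lie_algebra G T A.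
        induced_inner G h u y = induced_inner G h w (lie_bracket T A v y)))"

definition geodesic_vector ::
    "('a, 'b) monoid_scheme \<Rightarrow> 'a topology \<Rightarrow> ('a, 'e::euclidean_space) chart set \<Rightarrow>
     ('a \<Rightarrow> 'a tangent \<Rightarrow> 'a tangent \<Rightarrow> real) \<Rightarrow> ('a \<Rightarrow> 'a tangent) \<Rightarrow> bool"
  where "geodesic_vector G T A g v \<longleftrightarrow>
    (\<forall>y\<in>lie_algebra G T A. induced_inner G g v (lie_bracket T A v y) = 0)"

text \<open>
  The equation says that the Lie derivative of \<open>g\<close> along \<open>v\<close> vanishes on left-invariant fields;
  its derivative term is absent because \<open>g\<close> is constant on such fields.
\<close>

definition killing_vector ::
    "('a, 'b) monoid_scheme \<Rightarrow> 'a topology \<Rightarrow> ('a, 'e::euclidean_space) chart set \<Rightarrow>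
     ('a \<Rightarrow> 'a tangent \<Rightarrow> 'a tangent \<Rightarrow> real) \<Rightarrow> ('a \<Rightarrow> 'a tangent) \<Rightarrow> bool"
  where "killing_vector G T A g v \<longleftrightarrow>
    (\<forall>y\<in>lie_algebra G T A. \<forall>z\<in>lie_algebra G T A.
        induced_inner G g (lie_bracket T A v y) z + induced_inner G g y (lie_bracket T A v z) = 0)"

end

theory Submission
  imports Defs
begin

text \<open>
  Let \<open>n\<close> be the norm of \<open>X\<close>. For every left-invariant \<open>y\<close>, the pairing \<open>g\<^sub>X(v, [v, y])\<close> is
  \<open>1 + n\<close> times \<open>\<langle>v, [v, y]\<rangle> + \<langle>X, v\<rangle> \<langle>X, [v, y]\<rangle> / n\<close>. If \<open>v\<close> is a geodesic vector of \<open>h\<close>, the first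
  term vanishes, and the rest vanishes for all \<open>y\<close> iff \<open>\<langle>X, v\<rangle> = 0\<close> or the functional
  \<open>y \<mapsto> \<langle>X, [v, y]\<rangle>\<close> is zero. If \<open>v\<close> is a Killing vector of \<open>h\<close>, the Killing equation of \<open>g\<^sub>X\<close>
  becomes \<open>\<langle>X, [v, y]\<rangle> \<langle>X, z\<rangle> + \<langle>X, y\<rangle> \<langle>X, [v, z]\<rangle> = 0\<close>, up to a positive factor. Taking \<open>y = z = X\<close> gives
  \<open>\<langle>X, [v, X]\<rangle> = 0\<close>, and then \<open>z = X\<close> shows that the same functional is zero.

  What remains is that this functional vanishes iff \<open>ad_transpose\<close> of \<open>X\<close> does
  (\<open>ad_transpose_eq_zero_iff\<close>). One direction is uniqueness of a representing vector, from
  positive definiteness. The other requires that a representing vector exists, which is a Riesz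
  representation on the Lie algebra (\<open>lie_algebra_riesz\<close>) and depends on two facts.

  The first is that the Lie algebra has finite dimension. A left-invariant field is determined by its
  value at the identity, and a derivation of germs is determined by its values on the
  coordinates of a chart (\<open>tangent_eq_zeroI\<close>), by Hadamard's lemma (\<open>hadamard\<close>). Hence
  the Lie algebra embeds in the model space (\<open>lie_algebra_embedding\<close>), where an
  orthogonalisation argument produces the representing vector (\<open>riesz_subspace\<close>).

  The second is that the Lie algebra is closed under the bracket (\<open>lie_algebra_bracket\<close>), so that
  the inner products of brackets above make sense and are linear in \<open>y\<close>. Invariance of
  the bracket rests on left translations being smooth, which is obtained by restricting the
  multiplication to a slice \<open>{a} \<times> G\<close>, and on the chain rule (\<open>Ck_on_compose\<close>).
\<close>

section \<open>Calculus of \<open>C\<^sup>k\<close> functions\<close>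

lemma Ck_on_subset:
  assumes "Ck_on k S f" "S' \<subseteq> S"
  shows "Ck_on k S' f"
  using assms
proof (induction k arbitrary: f)
  case 0
  then show ?case using continuous_on_subset[of S f S'] by simp
next
  case (Suc k)
  then show ?case using differentiable_on_subset[of f S S'] by simp
qed

lemma Ck_on_SucD: "Ck_on (Suc k) S f \<Longrightarrow> Ck_on k S f"
proof (induction k arbitrary: f)
  case 0
  then show ?case by (simp add: differentiable_imp_continuous_on)
next
  case (Suc k)
  then have "f differentiable_on S" "Ck_on k S (\<lambda>x. frechet_derivative f (at x) v)" for v
    by (simp_all only: Ck_on.simps(2)[of "Suc k"])
  then show ?case by simp
qed

lemma Ck_on_Suc_has_derivative:
  assumes "Ck_on (Suc k) S f" "open S" "x \<in> S"
  shows "(f has_derivative frechet_derivative f (at x)) (at x)"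
  using assms by (auto simp: differentiable_on_def at_within_open[OF _ assms(2)] frechet_derivative_works)

lemma Ck_on_cong:
  assumes "open S" "\<And>x. x \<in> S \<Longrightarrow> f x = g x" "Ck_on k S f"
  shows "Ck_on k S g"
  using assms(2,3)
proof (induction k arbitrary: f g)
  case 0
  then show ?case by (simp cong: continuous_on_cong)
next
  case (Suc k)
  have f': "(f has_derivative frechet_derivative f (at x)) (at x)" if "x \<in> S" for x
    using Ck_on_Suc_has_derivative[OF Suc.prems(2) assms(1) that] .
  have g': "(g has_derivative frechet_derivative f (at x)) (at x)" if "x \<in> S" for x
    by (rule has_derivative_transform_within_open[OF f'[OF that] assms(1) that]) (rule Suc.prems(1))
  then have eq: "frechet_derivative g (at x) = frechet_derivative f (at x)" if "x \<in> S" for x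
    using frechet_derivative_at[OF g'[OF that]] by simp
  have "g differentiable_on S"
    unfolding differentiable_on_def
    by (intro ballI differentiableI[OF has_derivative_at_withinI[OF g']])
  moreover have "Ck_on k S (\<lambda>x. frechet_derivative g (at x) v)" for v
    by (rule Suc.IH[where f = "\<lambda>x. frechet_derivative f (at x) v"]) (use eq Suc.prems in auto)
  ultimately show ?case by simp
qed

lemma Ck_on_SucI:
  assumes "open S" "\<And>x. x \<in> S \<Longrightarrow> (f has_derivative f' x) (at x)"
    and "\<And>v. Ck_on k S (\<lambda>x. f' x v)"
  shows "Ck_on (Suc k) S f"
proof -
  have "f differentiable_on S"
    unfolding differentiable_on_def
    by (intro ballI differentiableI[OF has_derivative_at_withinI[OF assms(2)]])
  moreover have "Ck_on k S (\<lambda>x. frechet_derivative f (at x) v)" for v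
    by (rule Ck_on_cong[where f = "\<lambda>x. f' x v", OF assms(1) _ assms(3)])
      (simp add: frechet_derivative_at[OF assms(2), symmetric])
  ultimately show ?thesis by simp
qed

lemma Ck_on_local:
  assumes "\<And>x. x \<in> S \<Longrightarrow> \<exists>N. open N \<and> x \<in> N \<and> Ck_on k N f"
  shows "Ck_on k S f"
  using assms
proof (induction k arbitrary: f)
  case 0
  then show ?case
    by (auto intro!: continuous_at_imp_continuous_on) (meson continuous_on_eq_continuous_at)
next
  case (Suc k)
  have "f differentiable_on S"
    unfolding differentiable_on_def
  proof
    fix x assume "x \<in> S"
    from Suc.prems[OF this] obtain N where N: "open N" "x \<in> N" "Ck_on (Suc k) N f" by blast
    show "f differentiable at x within S"
      using Ck_on_Suc_has_derivative[OF N(3,1,2)] by (intro differentiableI[OF has_derivative_at_withinI])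
  qed
  moreover have "Ck_on k S (\<lambda>x. frechet_derivative f (at x) v)" for v
  proof (rule Suc.IH)
    fix x assume "x \<in> S"
    from Suc.prems[OF this] show "\<exists>N. open N \<and> x \<in> N \<and> Ck_on k N (\<lambda>x. frechet_derivative f (at x) v)"
      by auto
  qed
  ultimately show ?case by simp
qed

lemma Ck_on_const: "open S \<Longrightarrow> Ck_on k S (\<lambda>x. c)"
proof (induction k arbitrary: c)
  case (Suc k)
  show ?case by (rule Ck_on_SucI[where f' = "\<lambda>x v. 0"]) (use Suc in auto)
qed simp

lemma Ck_on_add:
  assumes "open S" "Ck_on k S f" "Ck_on k S g"
  shows "Ck_on k S (\<lambda>x. f x + g x)"
  using assms(2,3)
proof (induction k arbitrary: f g)
  case (Suc k)
  show ?case
    by (rule Ck_on_SucI[OF assms(1) has_derivative_add[OF Ck_on_Suc_has_derivative[OF Suc.prems(1) assms(1)]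
          Ck_on_Suc_has_derivative[OF Suc.prems(2) assms(1)]]])
      (use Suc in auto)
qed (simp add: continuous_on_add)

lemma Ck_on_sum:
  assumes "open S" "\<And>i. i \<in> I \<Longrightarrow> Ck_on k S (f i)"
  shows "Ck_on k S (\<lambda>x. \<Sum>i\<in>I. f i x)"
  using assms(2)
proof (induction I rule: infinite_finite_induct)
  case (insert i I)
  then show ?case by (simp add: Ck_on_add[OF assms(1)])
qed (simp_all add: Ck_on_const[OF assms(1)])

lemma Ck_on_bounded_linear:
  assumes "bounded_linear L" "open S" "Ck_on k S f"
  shows "Ck_on k S (\<lambda>x. L (f x))"
  using assms(3)
proof (induction k arbitrary: f)
  case 0
  then show ?case using bounded_linear.continuous_on[OF assms(1)] by simp
next
  case (Suc k)
  show ?case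
    by (rule Ck_on_SucI[OF assms(2) bounded_linear.has_derivative[OF assms(1)
            Ck_on_Suc_has_derivative[OF Suc.prems assms(2)]]])
      (use Suc in auto)
qed

lemma Ck_on_scaleR:
  assumes "open S" "Ck_on k S f" "Ck_on k S g"
  shows "Ck_on k S (\<lambda>x. f x *\<^sub>R g x)"
  using assms(2,3)
proof (induction k arbitrary: f g)
  case (Suc k)
  show ?case
  proof (rule Ck_on_SucI[OF assms(1) has_derivative_scaleR[OF
          Ck_on_Suc_has_derivative[OF Suc.prems(1) assms(1)]
          Ck_on_Suc_has_derivative[OF Suc.prems(2) assms(1)]]])
    fix v
    have "Ck_on k S (\<lambda>x. f x *\<^sub>R frechet_derivative g (at x) v)"
      by (rule Suc.IH[OF Ck_on_SucD[OF Suc.prems(1)]]) (use Suc.prems(2) in simp)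
    moreover have "Ck_on k S (\<lambda>x. frechet_derivative f (at x) v *\<^sub>R g x)"
      by (rule Suc.IH[OF _ Ck_on_SucD[OF Suc.prems(2)]]) (use Suc.prems(1) in simp)
    ultimately show "Ck_on k S (\<lambda>x. f x *\<^sub>R frechet_derivative g (at x) v +
        frechet_derivative f (at x) v *\<^sub>R g x)"
      by (rule Ck_on_add[OF assms(1)])
  qed
qed (simp add: continuous_on_scaleR)

lemma Ck_on_ident: "open S \<Longrightarrow> Ck_on k S (\<lambda>x. x)"
  by (cases k) (simp_all add: Ck_on_const)

lemma Ck_on_Pair_const: "open S \<Longrightarrow> Ck_on k S (\<lambda>x. (c, x))"
proof (cases k)
  case 0
  then show ?thesis by (simp add: continuous_on_Pair)
next
  case (Suc n)
  assume "open S"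
  then have "Ck_on (Suc n) S (\<lambda>x. (c, x))"
  proof (rule Ck_on_SucI[where f' = "\<lambda>x v. (0, v)"])
    show "((\<lambda>x. (c, x)) has_derivative (\<lambda>v. (0, v))) (at x)" for x
      by (rule has_derivative_Pair[OF has_derivative_const has_derivative_ident])
  qed (rule Ck_on_const[OF \<open>open S\<close>])
  then show ?thesis using Suc by simp
qed

text \<open>The \<open>v\<close>-derivative of \<open>g \<circ> f\<close> is the combination of the partial derivatives of \<open>g\<close>, taken at
  \<open>f x\<close>, whose coefficients are the coordinates of the \<open>v\<close>-derivative of \<open>f\<close>; so the induction on
  the order of differentiability only meets compositions with the same inner map.\<close>

lemma Ck_on_compose:
  fixes f :: "'a::real_normed_vector \<Rightarrow> 'b::euclidean_space"
    and g :: "'b \<Rightarrow> 'c::real_normed_vector"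
  assumes "open S" "open U" "f ` S \<subseteq> U" "Ck_on k S f" "Ck_on k U g"
  shows "Ck_on k S (\<lambda>x. g (f x))"
  using assms(4,5)
proof (induction k arbitrary: g)
  case 0
  then show ?case using continuous_on_compose2[of U g S f] assms(3) by simp
next
  case (Suc k)
  define D where "D y b = frechet_derivative g (at y) b" for y b
  have f': "(f has_derivative frechet_derivative f (at x)) (at x)" if "x \<in> S" for x
    using Ck_on_Suc_has_derivative[OF Suc.prems(1) assms(1) that] .
  have g': "(g has_derivative D y) (at y)" if "y \<in> U" for y
    unfolding D_def using Ck_on_Suc_has_derivative[OF Suc.prems(2) assms(2) that] .
  have "((\<lambda>x. g (f x)) has_derivative
      (\<lambda>v. \<Sum>b\<in>Basis. (frechet_derivative f (at x) v \<bullet> b) *\<^sub>R D (f x) b)) (at x)"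
    if x: "x \<in> S" for x
  proof -
    have gx: "(g has_derivative D (f x)) (at (f x))" by (rule g') (use x assms(3) in auto)
    have "((\<lambda>x. g (f x)) has_derivative (\<lambda>v. D (f x) (frechet_derivative f (at x) v))) (at x)"
      using has_derivative_compose[OF f'[OF x] gx] .
    moreover have "(\<lambda>v. D (f x) (frechet_derivative f (at x) v)) =
        (\<lambda>v. \<Sum>b\<in>Basis. (frechet_derivative f (at x) v \<bullet> b) *\<^sub>R D (f x) b)"
    proof
      fix v
      let ?w = "frechet_derivative f (at x) v"
      show "D (f x) ?w = (\<Sum>b\<in>Basis. (?w \<bullet> b) *\<^sub>R D (f x) b)"
        using linear_sum[OF has_derivative_linear[OF gx], of "\<lambda>b. (?w \<bullet> b) *\<^sub>R b" Basis]
        by (simp add: linear_scale[OF has_derivative_linear[OF gx]] euclidean_representation)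
    qed
    ultimately show ?thesis by (simp only:)
  qed
  then show ?case
  proof (rule Ck_on_SucI[OF assms(1)])
    fix v
    have "Ck_on k S (\<lambda>x. frechet_derivative f (at x) v \<bullet> b)" for b
      by (rule Ck_on_bounded_linear[OF bounded_linear_inner_left assms(1)]) (use Suc.prems(1) in simp)
    moreover have "Ck_on k S (\<lambda>x. D (f x) b)" for b
      by (rule Suc.IH[OF Ck_on_SucD[OF Suc.prems(1)]]) (use Suc.prems(2) in \<open>simp add: D_def\<close>)
    ultimately show "Ck_on k S (\<lambda>x. \<Sum>b\<in>Basis. (frechet_derivative f (at x) v \<bullet> b) *\<^sub>R D (f x) b)"
      by (rule Ck_on_sum[OF assms(1) Ck_on_scaleR[OF assms(1)]])
  qed
qed

lemma convex_segment_point: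
  fixes x p :: "'a::real_vector"
  assumes "convex S" "p \<in> S" "x \<in> S" "t \<in> {0..1::real}"
  shows "p + t *\<^sub>R (x - p) \<in> S"
  using convexD_alt[OF assms(1,2,3), of t] assms(4) by (simp add: algebra_simps)

text \<open>Differentiating under the integral sign multiplies the integrand by a further factor \<open>t\<close>;
  the power of \<open>t\<close> is there to make the induction go through.\<close>

lemma Ck_on_segment_integral:
  fixes F :: "'a::euclidean_space \<Rightarrow> real"
  assumes "open S" "convex S" "p \<in> S" "Ck_on k S F"
  shows "Ck_on k S (\<lambda>x. integral {0..1} (\<lambda>t. t ^ j * F (p + t *\<^sub>R (x - p))))"
  using assms(4)
proof (induction k arbitrary: F j)
  have cont: "continuous_on (S \<times> {0..1}) (\<lambda>(x, t). t ^ j * F (p + t *\<^sub>R (x - p)))"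
    if "continuous_on S F" for F :: "'a \<Rightarrow> real" and j
    unfolding case_prod_unfold
    by (intro continuous_intros continuous_on_compose2[OF that])
      (use convex_segment_point[OF assms(2,3)] in auto)
  {
    case 0
    then show ?case
      using integral_continuous_on_param[of S 0 1 "\<lambda>x t. t ^ j * F (p + t *\<^sub>R (x - p))"] cont
      by simp
  next
    case (Suc k)
    define D where "D y v = frechet_derivative F (at y) v" for y v
    have F': "(F has_derivative D y) (at y)" if "y \<in> S" for y
      unfolding D_def using Ck_on_Suc_has_derivative[OF Suc.prems assms(1) that] .
    have contD: "continuous_on S (\<lambda>y. D y v)" for v
    proof -
      have "Ck_on k S (\<lambda>y. D y v)" using Suc.prems by (simp add: D_def)
      then show ?thesis by (cases k) (simp_all add: differentiable_imp_continuous_on)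
    qed
    have contF: "continuous_on S F" using Suc.prems by (simp add: differentiable_imp_continuous_on)
    define B where "B x t = Blinfun (\<lambda>v. t ^ Suc j * D (p + t *\<^sub>R (x - p)) v)" for x t
    have blD: "bounded_linear (\<lambda>v. t ^ Suc j * D (p + t *\<^sub>R (x - p)) v)"
      if "x \<in> S" "t \<in> {0..1}" for x t
      using has_derivative_bounded_linear[OF F'[OF convex_segment_point[OF assms(2,3) that]]]
      by (rule bounded_linear_const_mult)
    have B: "blinfun_apply (B x t) = (\<lambda>v. t ^ Suc j * D (p + t *\<^sub>R (x - p)) v)"
      if "x \<in> S" "t \<in> {0..1}" for x t
      unfolding B_def using bounded_linear_Blinfun_apply[OF blD[OF that]] .
    have contB: "continuous_on (S \<times> {0..1}) (\<lambda>(x, t). B x t)"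
    proof (rule continuous_on_blinfun_componentwise)
      fix i :: 'a
      have "continuous_on (S \<times> {0..1}) (\<lambda>(x, t). B x t i) \<longleftrightarrow>
          continuous_on (S \<times> {0..1}) (\<lambda>(x, t). t ^ Suc j * D (p + t *\<^sub>R (x - p)) i)"
        by (rule continuous_on_cong) (use B in auto)
      then show "continuous_on (S \<times> {0..1}) (\<lambda>z. blinfun_apply (case z of (x, t) \<Rightarrow> B x t) i)"
        using cont[OF contD, of "Suc j" i] by (simp add: case_prod_unfold)
    qed
    have deriv: "((\<lambda>x. t ^ j * F (p + t *\<^sub>R (x - p))) has_derivative blinfun_apply (B x t)) (at x within S)"
      if x: "x \<in> S" and t: "t \<in> {0..1}" for x t
    proof -
      have y: "(F has_derivative D (p + t *\<^sub>R (x - p))) (at (p + t *\<^sub>R (x - p)))"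
        using F'[OF convex_segment_point[OF assms(2,3) x t]] .
      have "((\<lambda>x. p + t *\<^sub>R (x - p)) has_derivative (\<lambda>v. t *\<^sub>R v)) (at x within S)"
        by (auto intro!: derivative_eq_intros)
      from has_derivative_compose[OF this y]
      have "((\<lambda>x. t ^ j * F (p + t *\<^sub>R (x - p))) has_derivative
          (\<lambda>v. t ^ j * D (p + t *\<^sub>R (x - p)) (t *\<^sub>R v))) (at x within S)"
        by (intro has_derivative_mult_right)
      moreover have "D (p + t *\<^sub>R (x - p)) (t *\<^sub>R v) = t * D (p + t *\<^sub>R (x - p)) v" for v
        using linear_scale[OF has_derivative_linear[OF y]] by simp
      ultimately show ?thesis by (simp add: B[OF x t] mult.assoc mult.commute mult.left_commute)
    qed
    have int: "(\<lambda>t. t ^ j * F (p + t *\<^sub>R (x - p))) integrable_on cbox 0 1" if "x \<in> S" for x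
    proof (rule integrable_continuous)
      show "continuous_on (cbox 0 1) (\<lambda>t. t ^ j * F (p + t *\<^sub>R (x - p)))"
        by (intro continuous_intros continuous_on_compose2[OF contF])
          (use convex_segment_point[OF assms(2,3) that] in auto)
    qed
    have "((\<lambda>x. integral {0..1} (\<lambda>t. t ^ j * F (p + t *\<^sub>R (x - p)))) has_derivative
        (\<lambda>v. integral {0..1} (\<lambda>t. t ^ Suc j * D (p + t *\<^sub>R (x - p)) v))) (at x)" if x: "x \<in> S" for x
    proof -
      have leibniz: "((\<lambda>x. integral (cbox 0 1) (\<lambda>t. t ^ j * F (p + t *\<^sub>R (x - p)))) has_derivative
        blinfun_apply (integral (cbox 0 1) (B x))) (at x within S)"
        by (rule leibniz_rule[OF _ int _ x assms(2)]) (use deriv contB in auto)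
      have apply_integral: "blinfun_apply (integral (cbox 0 1) (B x)) v =
          integral (cbox 0 1) (\<lambda>t. t ^ Suc j * D (p + t *\<^sub>R (x - p)) v)" for v
      proof -
        have "B x integrable_on cbox 0 1"
        proof (rule integrable_continuous)
          have "continuous_on (cbox 0 1) (\<lambda>t. case (x, t) of (x, t) \<Rightarrow> B x t)"
            by (rule continuous_on_compose2[OF contB continuous_on_Pair[OF continuous_on_const continuous_on_id]])
              (use x in auto)
          then show "continuous_on (cbox 0 1) (B x)" by simp
        qed
        then have "blinfun_apply (integral (cbox 0 1) (B x)) v = integral (cbox 0 1) (\<lambda>t. B x t v)"
          by (rule blinfun_apply_integral)
        also have "\<dots> = integral (cbox 0 1) (\<lambda>t. t ^ Suc j * D (p + t *\<^sub>R (x - p)) v)"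
          by (rule integral_cong) (use B[OF x] in auto)
        finally show ?thesis .
      qed
      have "((\<lambda>x. integral (cbox 0 1) (\<lambda>t. t ^ j * F (p + t *\<^sub>R (x - p)))) has_derivative
        (\<lambda>v. integral (cbox 0 1) (\<lambda>t. t ^ Suc j * D (p + t *\<^sub>R (x - p)) v))) (at x within S)"
        by (rule has_derivative_eq_rhs[OF leibniz]) (rule ext, rule apply_integral)
      then show ?thesis
        using at_within_open[OF x assms(1)] by (simp only: cbox_interval)
    qed
    then show ?case
    proof (rule Ck_on_SucI[OF assms(1)])
      fix v
      have "Ck_on k S (\<lambda>y. D y v)" using Suc.prems by (simp add: D_def)
      then show "Ck_on k S (\<lambda>x. integral {0..1} (\<lambda>t. t ^ Suc j * D (p + t *\<^sub>R (x - p)) v))"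
        by (rule Suc.IH)
    qed
  }
qed

text \<open>Hadamard's lemma. By the fundamental theorem of calculus along the segment from \<open>p\<close> to \<open>x\<close>,
  \<open>f x - f p\<close> is the integral of the derivative in the direction \<open>x - p\<close>; the factors \<open>g b\<close> are
  the averages of the partial derivatives of \<open>f\<close> over that segment.\<close>

lemma hadamard:
  fixes f :: "'a::euclidean_space \<Rightarrow> real"
  assumes "open S" "convex S" "p \<in> S" "smooth_on S f"
  obtains g where "\<And>b. smooth_on S (g b)"
    "\<And>x. x \<in> S \<Longrightarrow> f x = f p + (\<Sum>b\<in>Basis. ((x - p) \<bullet> b) * g b x)"
proof
  define D where "D y v = frechet_derivative f (at y) v" for y v
  define g where "g b x = integral {0..1} (\<lambda>t. t ^ 0 * D (p + t *\<^sub>R (x - p)) b)" for b x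
  have f: "Ck_on k S f" for k using assms(4) by (simp add: smooth_on_def)
  have D: "Ck_on k S (\<lambda>y. D y b)" for k b
    using f[of "Suc k"] by (simp add: D_def)
  have f': "(f has_derivative D y) (at y)" if "y \<in> S" for y
    unfolding D_def using Ck_on_Suc_has_derivative[OF f assms(1) that] .
  show "smooth_on S (g b)" for b
    unfolding smooth_on_def g_def using Ck_on_segment_integral[OF assms(1-3) D] by blast
  fix x assume x: "x \<in> S"
  have seg: "p + t *\<^sub>R (x - p) \<in> S" if "t \<in> {0..1}" for t
    using convex_segment_point[OF assms(2,3) x that] .
  have split: "D (p + t *\<^sub>R (x - p)) (s *\<^sub>R (x - p)) =
      s * (\<Sum>b\<in>Basis. ((x - p) \<bullet> b) * D (p + t *\<^sub>R (x - p)) b)" if "t \<in> {0..1}" for s t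
  proof -
    have lin: "linear (D (p + t *\<^sub>R (x - p)))" using has_derivative_linear[OF f'[OF seg[OF that]]] .
    have "D (p + t *\<^sub>R (x - p)) (x - p) =
        D (p + t *\<^sub>R (x - p)) (\<Sum>b\<in>Basis. ((x - p) \<bullet> b) *\<^sub>R b)"
      by (simp only: euclidean_representation)
    also have "\<dots> = (\<Sum>b\<in>Basis. ((x - p) \<bullet> b) * D (p + t *\<^sub>R (x - p)) b)"
      by (simp add: linear_sum[OF lin] linear_scale[OF lin])
    finally show ?thesis by (simp add: linear_scale[OF lin])
  qed
  have "((\<lambda>t. \<Sum>b\<in>Basis. ((x - p) \<bullet> b) * D (p + t *\<^sub>R (x - p)) b) has_integral
      f (p + 1 *\<^sub>R (x - p)) - f (p + 0 *\<^sub>R (x - p))) {0..1}"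
  proof (rule fundamental_theorem_of_calculus)
    fix t :: real assume t: "t \<in> {0..1}"
    have "((\<lambda>t. p + t *\<^sub>R (x - p)) has_derivative (\<lambda>s. s *\<^sub>R (x - p))) (at t within {0..1})"
      by (auto intro!: derivative_eq_intros)
    from has_derivative_compose[OF this f'[OF seg[OF t]]]
    show "((\<lambda>t. f (p + t *\<^sub>R (x - p))) has_vector_derivative
        (\<Sum>b\<in>Basis. ((x - p) \<bullet> b) * D (p + t *\<^sub>R (x - p)) b)) (at t within {0..1})"
      unfolding has_vector_derivative_def by (simp add: split[OF t])
  qed simp
  moreover have "((\<lambda>t. \<Sum>b\<in>Basis. ((x - p) \<bullet> b) * D (p + t *\<^sub>R (x - p)) b) has_integral
      (\<Sum>b\<in>Basis. ((x - p) \<bullet> b) * g b x)) {0..1}"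
  proof (intro has_integral_sum finite_Basis has_integral_mult_right)
    fix b :: 'a
    have "continuous_on {0..1} (\<lambda>t. D (p + t *\<^sub>R (x - p)) b)"
      by (rule continuous_on_compose2[OF D[of 0, simplified]]) (use seg in \<open>auto intro!: continuous_intros\<close>)
    then show "((\<lambda>t. D (p + t *\<^sub>R (x - p)) b) has_integral g b x) {0..1}"
      unfolding g_def by (simp add: integrable_continuous_real integrable_integral)
  qed
  ultimately have "f (p + 1 *\<^sub>R (x - p)) - f (p + 0 *\<^sub>R (x - p)) =
      (\<Sum>b\<in>Basis. ((x - p) \<bullet> b) * g b x)"
    by (rule has_integral_unique)
  then show "f x = f p + (\<Sum>b\<in>Basis. ((x - p) \<bullet> b) * g b x)"
    by simp
qed

section \<open>Smooth functions on a manifold\<close>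

locale atlas_space =
  fixes T :: "'a topology" and A :: "('a, 'e::euclidean_space) chart set"
  assumes atlas: "smooth_atlas T A"
begin

lemma
  assumes "(U, \<phi>) \<in> A"
  shows chart_domain_open: "openin T U"
    and chart_range_open: "open (\<phi> ` U)"
    and chart_homeomorphic: "homeomorphic_map (subtopology T U) (top_of_set (\<phi> ` U)) \<phi>"
  using atlas assms unfolding smooth_atlas_def by auto

lemma chart_inj: "(U, \<phi>) \<in> A \<Longrightarrow> inj_on \<phi> U"
  using homeomorphic_imp_injective_map[OF chart_homeomorphic]
    openin_subset[OF chart_domain_open] by (simp add: Int_absorb1)

lemma chart_image_open:
  assumes "(U, \<phi>) \<in> A" "openin T S"
  shows "open (\<phi> ` (U \<inter> S))"
proof -
  have "openin (top_of_set (\<phi> ` U)) (\<phi> ` (U \<inter> S))"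
    using homeomorphic_imp_open_map[OF chart_homeomorphic[OF assms(1)]] assms(2)
    unfolding open_map_def by (simp add: openin_subtopology_Int2)
  then show ?thesis using openin_open_trans chart_range_open[OF assms(1)] by blast
qed

lemma chart_preimage_open:
  assumes "(U, \<phi>) \<in> A" "open N"
  shows "openin T {x \<in> U. \<phi> x \<in> N}"
proof -
  have "continuous_map (subtopology T U) (top_of_set (\<phi> ` U)) \<phi>"
    using homeomorphic_imp_continuous_map[OF chart_homeomorphic[OF assms(1)]] .
  then have "continuous_map (subtopology T U) euclidean \<phi>"
    using continuous_map_into_fulltopology by blast
  then have "openin (subtopology T U) {x \<in> topspace (subtopology T U). \<phi> x \<in> N}"
    using assms(2) by (auto simp: continuous_map_def)
  moreover have "topspace (subtopology T U) = U"
    using openin_subset[OF chart_domain_open[OF assms(1)]] by auto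
  ultimately have "openin (subtopology T U) {x \<in> U. \<phi> x \<in> N}" by (simp only:)
  then show ?thesis
    by (rule openin_trans_full[OF _ chart_domain_open[OF assms(1)]])
qed

lemma chart_around:
  assumes "p \<in> topspace T"
  obtains U \<phi> where "(U, \<phi>) \<in> A" "p \<in> U"
proof -
  have "p \<in> \<Union> (fst ` A)" using atlas assms by (simp add: smooth_atlas_def)
  then show ?thesis using that by auto
qed

lemma smooth_transition:
  assumes "(U, \<phi>) \<in> A" "(V, \<psi>) \<in> A"
  shows "Ck_on k (\<phi> ` (U \<inter> V)) (\<psi> \<circ> inv_into U \<phi>)"
  using atlas assms unfolding smooth_atlas_def smooth_on_def by fast

lemma prod_chart_image_open:
  assumes "(U, \<phi>) \<in> A" "(V, \<psi>) \<in> A" "openin (prod_topology T T) D" "D \<subseteq> U \<times> V"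
  shows "open (map_prod \<phi> \<psi> ` D)"
proof -
  have "\<exists>O'. open O' \<and> e \<in> O' \<and> O' \<subseteq> map_prod \<phi> \<psi> ` D" if e: "e \<in> map_prod \<phi> \<psi> ` D" for e
  proof -
  obtain x y where xy: "(x, y) \<in> D" "e = (\<phi> x, \<psi> y)" using e by auto
  have "\<exists>M N. openin T M \<and> openin T N \<and> x \<in> M \<and> y \<in> N \<and> M \<times> N \<subseteq> D"
    using assms(3) xy(1) by (simp only: openin_prod_topology_alt)
  then obtain M N where MN: "openin T M" "openin T N" "x \<in> M" "y \<in> N" "M \<times> N \<subseteq> D"
    by (elim exE conjE)
  have "map_prod \<phi> \<psi> ` (M \<times> N) = \<phi> ` M \<times> \<psi> ` N" by auto
  moreover have "open (\<phi> ` M)" "open (\<psi> ` N)"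
  proof -
    have "M \<subseteq> U" "N \<subseteq> V" using MN assms(4) by blast+
    then have "U \<inter> M = M" "V \<inter> N = N" by auto
    then show "open (\<phi> ` M)" "open (\<psi> ` N)"
      using chart_image_open[OF assms(1) MN(1)] chart_image_open[OF assms(2) MN(2)] by simp_all
  qed
  ultimately have "open (map_prod \<phi> \<psi> ` (M \<times> N))" by (simp add: open_Times)
  moreover have "e \<in> map_prod \<phi> \<psi> ` (M \<times> N)" using xy MN by auto
  moreover have "map_prod \<phi> \<psi> ` (M \<times> N) \<subseteq> map_prod \<phi> \<psi> ` D" using MN(5) by (rule image_mono)
  ultimately show ?thesis by blast
  qed
  then show ?thesis by (subst open_subopen) blast
qed

lemma smooth_fun_onI:
  assumes "\<And>U \<phi> k. (U, \<phi>) \<in> A \<Longrightarrow> Ck_on k (\<phi> ` (U \<inter> S)) (\<lambda>e. f (inv_into U \<phi> e))"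
  shows "smooth_fun_on A S f"
  using assms by (auto simp: smooth_fun_on_def smooth_on_def o_def)

lemma smooth_fun_onD:
  assumes "smooth_fun_on A S f" "(U, \<phi>) \<in> A"
  shows "Ck_on k (\<phi> ` (U \<inter> S)) (\<lambda>e. f (inv_into U \<phi> e))"
  using assms by (auto simp: smooth_fun_on_def smooth_on_def o_def)

lemma smooth_fun_on_subset:
  assumes "smooth_fun_on A S f" "S' \<subseteq> S"
  shows "smooth_fun_on A S' f"
  by (rule smooth_fun_onI, rule Ck_on_subset[OF smooth_fun_onD[OF assms(1)]]) (use assms(2) in auto)

lemma smooth_fun_on_cong:
  assumes "openin T S" "\<And>x. x \<in> S \<Longrightarrow> f x = g x" "smooth_fun_on A S f"
  shows "smooth_fun_on A S g"
proof (rule smooth_fun_onI)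
  fix U \<phi> k assume c: "(U, \<phi>) \<in> A"
  show "Ck_on k (\<phi> ` (U \<inter> S)) (\<lambda>e. g (inv_into U \<phi> e))"
    by (rule Ck_on_cong[OF chart_image_open[OF c assms(1)] _ smooth_fun_onD[OF assms(3) c]])
      (use assms(2) inv_into_f_f[OF chart_inj[OF c]] in auto)
qed

lemma smooth_fun_on_const: "openin T S \<Longrightarrow> smooth_fun_on A S (\<lambda>x. c)"
  by (rule smooth_fun_onI) (rule Ck_on_const[OF chart_image_open])

lemma smooth_fun_on_add:
  "\<lbrakk>openin T S; smooth_fun_on A S f; smooth_fun_on A S g\<rbrakk> \<Longrightarrow> smooth_fun_on A S (\<lambda>x. f x + g x)"
  by (rule smooth_fun_onI) (rule Ck_on_add[OF chart_image_open]; (assumption | rule smooth_fun_onD))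

lemma smooth_fun_on_mult:
  assumes "openin T S" "smooth_fun_on A S f" "smooth_fun_on A S g"
  shows "smooth_fun_on A S (\<lambda>x. f x * g x)"
proof (rule smooth_fun_onI)
  fix U \<phi> k assume c: "(U, \<phi>) \<in> A"
  show "Ck_on k (\<phi> ` (U \<inter> S)) (\<lambda>e. f (inv_into U \<phi> e) * g (inv_into U \<phi> e))"
    using Ck_on_scaleR[OF chart_image_open[OF c assms(1)] smooth_fun_onD[OF assms(2) c]
        smooth_fun_onD[OF assms(3) c]] by simp
qed

lemma smooth_fun_on_diff:
  assumes "openin T S" "smooth_fun_on A S f" "smooth_fun_on A S g"
  shows "smooth_fun_on A S (\<lambda>x. f x - g x)"
  using smooth_fun_on_add[OF assms(1,2) smooth_fun_on_mult[OF assms(1) smooth_fun_on_const[OF assms(1), of "-1"] assms(3)]]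
  by simp

text \<open>In another chart, the function is \<open>g\<close> composed with a transition map.\<close>

lemma smooth_fun_on_chart:
  fixes g :: "'e \<Rightarrow> real"
  assumes c: "(U, \<phi>) \<in> A" and N: "open N" and g: "smooth_on N g"
  shows "smooth_fun_on A {x \<in> U. \<phi> x \<in> N} (\<lambda>x. g (\<phi> x))"
proof (rule smooth_fun_onI)
  fix V \<psi> k assume d: "(V, \<psi>) \<in> A"
  let ?S = "\<psi> ` (V \<inter> {x \<in> U. \<phi> x \<in> N})"
  show "Ck_on k ?S (\<lambda>e. g (\<phi> (inv_into V \<psi> e)))"
  proof (rule Ck_on_compose[OF chart_image_open[OF d chart_preimage_open[OF c N]] N])
    show "(\<lambda>e. \<phi> (inv_into V \<psi> e)) ` ?S \<subseteq> N"
      using inv_into_f_f[OF chart_inj[OF d]] by auto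
    show "Ck_on k ?S (\<lambda>e. \<phi> (inv_into V \<psi> e))"
      using Ck_on_subset[OF smooth_transition[OF d c], of ?S k] by (auto simp: o_def)
    show "Ck_on k N g" using g by (simp add: smooth_on_def)
  qed
qed

section \<open>Germs and tangent vectors\<close>

lemma smooth_near_topspace: "smooth_near T A p f \<Longrightarrow> p \<in> topspace T"
  unfolding smooth_near_def using openin_subset by blast

lemma smooth_nearI: "\<lbrakk>openin T S; p \<in> S; smooth_fun_on A S f\<rbrakk> \<Longrightarrow> smooth_near T A p f"
  unfolding smooth_near_def by blast

lemma smooth_near_eventually:
  "smooth_near T A p f \<Longrightarrow> eventually (\<lambda>q. smooth_near T A q f) (nhdsin T p)"
  unfolding smooth_near_def eventually_nhdsin by blast

lemma smooth_near_cong: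
  assumes "eventually (\<lambda>q. f q = g q) (nhdsin T p)" "smooth_near T A p f"
  shows "smooth_near T A p g"
proof -
  obtain S where S: "openin T S" "p \<in> S" "smooth_fun_on A S f"
    using assms(2) unfolding smooth_near_def by blast
  obtain N where N: "openin T N" "p \<in> N" "\<forall>q\<in>N. f q = g q"
    using assms(1) smooth_near_topspace[OF assms(2)] unfolding eventually_nhdsin by blast
  have o: "openin T (S \<inter> N)" using S N by blast
  have "smooth_fun_on A (S \<inter> N) g"
    by (rule smooth_fun_on_cong[OF o _ smooth_fun_on_subset[OF S(3)]]) (use N in auto)
  then show ?thesis using S N o by (intro smooth_nearI[OF o]) auto
qed

lemma smooth_near_const: "p \<in> topspace T \<Longrightarrow> smooth_near T A p (\<lambda>x. c)"
  by (rule smooth_nearI[of "topspace T"]) (auto intro: smooth_fun_on_const)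

lemma smooth_near_common:
  assumes "smooth_near T A p f" "smooth_near T A p g"
  obtains S where "openin T S" "p \<in> S" "smooth_fun_on A S f" "smooth_fun_on A S g"
proof -
  obtain S S' where S: "openin T S" "p \<in> S" "smooth_fun_on A S f"
    and S': "openin T S'" "p \<in> S'" "smooth_fun_on A S' g"
    using assms unfolding smooth_near_def by blast
  show ?thesis
    by (rule that[of "S \<inter> S'"])
      (use S S' smooth_fun_on_subset[OF S(3), of "S \<inter> S'"] smooth_fun_on_subset[OF S'(3), of "S \<inter> S'"] in auto)
qed

lemma smooth_near_add:
  assumes "smooth_near T A p f" "smooth_near T A p g"
  shows "smooth_near T A p (\<lambda>x. f x + g x)"
  by (rule smooth_near_common[OF assms]) (auto intro: smooth_nearI smooth_fun_on_add)

lemma smooth_near_mult: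
  assumes "smooth_near T A p f" "smooth_near T A p g"
  shows "smooth_near T A p (\<lambda>x. f x * g x)"
  by (rule smooth_near_common[OF assms]) (auto intro: smooth_nearI smooth_fun_on_mult)

lemma smooth_near_scale: "smooth_near T A p f \<Longrightarrow> smooth_near T A p (\<lambda>x. c * f x)"
  by (rule smooth_near_mult[OF smooth_near_const[OF smooth_near_topspace]])

lemma smooth_near_sum:
  assumes "p \<in> topspace T" "\<And>i. i \<in> I \<Longrightarrow> smooth_near T A p (f i)"
  shows "smooth_near T A p (\<lambda>x. \<Sum>i\<in>I. f i x)"
  using assms(2)
  by (induction I rule: infinite_finite_induct)
    (simp_all add: smooth_near_const[OF assms(1)] smooth_near_add)

text \<open>The germ relation is phrased with the neighbourhood filter, so that finitely many germ
  equalities combine without naming neighbourhoods.\<close>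

lemma tangent_spaceI:
  assumes "\<And>f g. smooth_near T A p f \<Longrightarrow> smooth_near T A p g \<Longrightarrow> t (\<lambda>x. f x + g x) = t f + t g"
    and "\<And>f g. smooth_near T A p f \<Longrightarrow> smooth_near T A p g \<Longrightarrow>
      t (\<lambda>x. f x * g x) = t f * g p + f p * t g"
    and "\<And>c f. smooth_near T A p f \<Longrightarrow> t (\<lambda>x. c * f x) = c * t f"
    and "\<And>f g. smooth_near T A p f \<Longrightarrow> smooth_near T A p g \<Longrightarrow>
      eventually (\<lambda>q. f q = g q) (nhdsin T p) \<Longrightarrow> t f = t g"
    and "\<And>f. \<not> smooth_near T A p f \<Longrightarrow> t f = 0"
  shows "t \<in> tangent_space T A p"
proof -
  have "t f = t g"
    if "smooth_near T A p f" "smooth_near T A p g" "\<exists>S. openin T S \<and> p \<in> S \<and> (\<forall>x\<in>S. f x = g x)" for f g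
    using assms(4)[OF that(1,2)] that(3) by (simp add: eventually_nhdsin)
  then show ?thesis using assms(1,2,3,5) by (simp add: tangent_space_def)
qed

context
  fixes p t assumes t: "t \<in> tangent_space T A p"
begin

lemma tangent_add:
  "smooth_near T A p f \<Longrightarrow> smooth_near T A p g \<Longrightarrow> t (\<lambda>x. f x + g x) = t f + t g"
  and tangent_mult:
  "smooth_near T A p f \<Longrightarrow> smooth_near T A p g \<Longrightarrow> t (\<lambda>x. f x * g x) = t f * g p + f p * t g"
  and tangent_scale: "smooth_near T A p f \<Longrightarrow> t (\<lambda>x. c * f x) = c * t f"
  and tangent_not_smooth: "\<not> smooth_near T A p f \<Longrightarrow> t f = 0"
  using t unfolding tangent_space_def by auto

text \<open>Smoothness near \<open>p\<close> is a property of the germ, and a tangent vector takes the value \<open>0\<close> on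
  every germ that is not smooth.\<close>

lemma tangent_cong:
  assumes "eventually (\<lambda>q. f q = g q) (nhdsin T p)"
  shows "t f = t g"
proof (cases "smooth_near T A p f")
  case True
  then have g: "smooth_near T A p g" using smooth_near_cong assms by blast
  have "\<exists>S. openin T S \<and> p \<in> S \<and> (\<forall>x\<in>S. f x = g x)"
    using assms smooth_near_topspace[OF True] by (simp add: eventually_nhdsin)
  then show ?thesis using t True g unfolding tangent_space_def by blast
next
  case False
  have "eventually (\<lambda>q. g q = f q) (nhdsin T p)" by (rule eventually_mono[OF assms]) simp
  then have "\<not> smooth_near T A p g" using False smooth_near_cong by blast
  then show ?thesis using False tangent_not_smooth by simp
qed

lemma tangent_const: "p \<in> topspace T \<Longrightarrow> t (\<lambda>x. c) = 0"
  using tangent_mult[of "\<lambda>x. 1" "\<lambda>x. 1"] tangent_scale[of "\<lambda>x. 1" c]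
  by (simp add: smooth_near_const)

lemma tangent_sum:
  assumes "p \<in> topspace T" "\<And>i. i \<in> I \<Longrightarrow> smooth_near T A p (f i)"
  shows "t (\<lambda>x. \<Sum>i\<in>I. f i x) = (\<Sum>i\<in>I. t (f i))"
  using assms(2)
proof (induction I rule: infinite_finite_induct)
  case (insert i I)
  then show ?case
    using tangent_add[of "f i" "\<lambda>x. \<Sum>i\<in>I. f i x"] smooth_near_sum[OF assms(1), of I f] by simp
qed (simp_all add: tangent_const[OF assms(1)])

end

lemma tangent_zero: "(\<lambda>f. 0) \<in> tangent_space T A p"
  by (rule tangent_spaceI) auto

lemma tangent_plus:
  assumes "s \<in> tangent_space T A p" "t \<in> tangent_space T A p"
  shows "(\<lambda>f. s f + t f) \<in> tangent_space T A p"
proof (rule tangent_spaceI)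
  show "s f + t f = s g + t g" if "eventually (\<lambda>q. f q = g q) (nhdsin T p)" for f g
    using assms[THEN tangent_cong, OF that] by simp
qed (simp_all add: assms[THEN tangent_add] assms[THEN tangent_mult] assms[THEN tangent_scale]
    assms[THEN tangent_not_smooth] algebra_simps)

lemma tangent_times:
  assumes "t \<in> tangent_space T A p"
  shows "(\<lambda>f. c * t f) \<in> tangent_space T A p"
proof (rule tangent_spaceI)
  show "c * t f = c * t g" if "eventually (\<lambda>q. f q = g q) (nhdsin T p)" for f g
    using tangent_cong[OF assms that] by simp
qed (simp_all add: tangent_add[OF assms] tangent_mult[OF assms] tangent_scale[OF assms]
    tangent_not_smooth[OF assms] algebra_simps)

definition coordinate :: "('a \<Rightarrow> 'e) \<Rightarrow> 'a \<Rightarrow> 'e \<Rightarrow> 'a \<Rightarrow> real"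
  where "coordinate \<phi> p b x = (\<phi> x - \<phi> p) \<bullet> b"

lemma smooth_near_coordinate:
  assumes "(U, \<phi>) \<in> A" "p \<in> U"
  shows "smooth_near T A p (coordinate \<phi> p b)"
proof (rule smooth_nearI[OF chart_domain_open[OF assms(1)] assms(2)])
  have "smooth_on UNIV (\<lambda>e. (e - \<phi> p) \<bullet> b)"
    unfolding smooth_on_def
  proof
    fix k
    have "Ck_on k UNIV (\<lambda>e. e \<bullet> b + - (\<phi> p \<bullet> b))"
      by (intro Ck_on_add Ck_on_const Ck_on_bounded_linear[OF bounded_linear_inner_left] Ck_on_ident open_UNIV)
    then show "Ck_on k UNIV (\<lambda>e. (e - \<phi> p) \<bullet> b)" by (simp add: inner_diff_left)
  qed
  from smooth_fun_on_chart[OF assms(1) open_UNIV this]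
  show "smooth_fun_on A U (coordinate \<phi> p b)" by (simp add: coordinate_def[abs_def])
qed

text \<open>Near \<open>p\<close>, Hadamard's lemma writes a smooth function \<open>f\<close> as \<open>f p\<close> plus products of coordinates
  and smooth functions. The coordinates vanish at \<open>p\<close>, so the Leibniz rule leaves only the terms
  where \<open>t\<close> acts on a coordinate. Applied to differences, this embeds the tangent space in the
  model space.\<close>

lemma tangent_eq_zeroI:
  assumes c: "(U, \<phi>) \<in> A" "p \<in> U" and t: "t \<in> tangent_space T A p"
    and zero: "\<And>b. b \<in> Basis \<Longrightarrow> t (coordinate \<phi> p b) = 0"
  shows "t = (\<lambda>f. 0)"
proof
  fix f
  show "t f = 0"
  proof (cases "smooth_near T A p f")
    case False
    then show ?thesis using tangent_not_smooth[OF t] by blast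
  next
    case True
    then obtain S where S: "openin T S" "p \<in> S" "smooth_fun_on A S f"
      unfolding smooth_near_def by blast
    have inv: "inv_into U \<phi> (\<phi> x) = x" if "x \<in> U" for x
      using inv_into_f_f[OF chart_inj[OF c(1)] that] .
    obtain r where r: "r > 0" "ball (\<phi> p) r \<subseteq> \<phi> ` (U \<inter> S)"
      using openE[OF chart_image_open[OF c(1) S(1)], of "\<phi> p"] c(2) S(2) by blast
    define B where "B = ball (\<phi> p) r"
    have B: "open B" "convex B" "\<phi> p \<in> B" using r by (auto simp: B_def)
    have "smooth_on B (\<lambda>e. f (inv_into U \<phi> e))"
      unfolding smooth_on_def B_def using Ck_on_subset[OF smooth_fun_onD[OF S(3) c(1)] r(2)] by blast
    from hadamard[OF B this] obtain g where g: "\<And>b. smooth_on B (g b)"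
      "\<And>e. e \<in> B \<Longrightarrow> f (inv_into U \<phi> e) = f (inv_into U \<phi> (\<phi> p)) + (\<Sum>b\<in>Basis. ((e - \<phi> p) \<bullet> b) * g b e)"
      by blast
    define W where "W = {x \<in> U. \<phi> x \<in> B}"
    have W: "openin T W" "p \<in> W"
      using chart_preimage_open[OF c(1) B(1)] c(2) B(3) by (auto simp: W_def)
    have pT: "p \<in> topspace T" using smooth_near_topspace[OF True] .
    have sg: "smooth_near T A p (\<lambda>x. g b (\<phi> x))" for b
      by (rule smooth_nearI[OF W]) (use smooth_fun_on_chart[OF c(1) B(1) g(1)] in \<open>simp add: W_def\<close>)
    have sc: "smooth_near T A p (coordinate \<phi> p b)" for b
      using smooth_near_coordinate[OF c] .
    let ?h = "\<lambda>b x. coordinate \<phi> p b x * g b (\<phi> x)"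
    have sh: "smooth_near T A p (?h b)" for b
      using smooth_near_mult[OF sc sg] .
    have "f x = f p + (\<Sum>b\<in>Basis. ?h b x)" if "x \<in> W" for x
      using g(2)[of "\<phi> x"] that inv c(2) by (simp add: W_def coordinate_def)
    then have "eventually (\<lambda>x. f x = f p + (\<Sum>b\<in>Basis. ?h b x)) (nhdsin T p)"
      using W unfolding eventually_nhdsin by blast
    then have "t f = t (\<lambda>x. f p + (\<Sum>b\<in>Basis. ?h b x))"
      by (rule tangent_cong[OF t])
    also have "\<dots> = t (\<lambda>x. f p) + t (\<lambda>x. \<Sum>b\<in>Basis. ?h b x)"
      by (rule tangent_add[OF t smooth_near_const[OF pT] smooth_near_sum[OF pT sh]])
    also have "\<dots> = (\<Sum>b\<in>Basis. t (?h b))"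
      by (simp add: tangent_const[OF t pT] tangent_sum[OF t pT sh])
    also have "\<dots> = 0"
      by (rule sum.neutral) (simp add: tangent_mult[OF t sc sg] zero, simp add: coordinate_def)
    finally show ?thesis .
  qed
qed

section \<open>Vector fields and their bracket\<close>

context
  fixes V assumes V: "V \<in> vector_fields T A"
begin

lemma vector_field_tangent: "V p \<in> tangent_space T A p"
  using V tangent_zero by (cases "p \<in> topspace T") (auto simp: vector_fields_def smooth_vector_field_on_def)

lemma vector_field_smooth:
  "openin T S \<Longrightarrow> smooth_fun_on A S f \<Longrightarrow> smooth_fun_on A S (\<lambda>p. V p f)"
  using V openin_subset[of T S] by (simp add: vector_fields_def smooth_vector_field_on_def)

lemma vector_field_outside: "p \<notin> topspace T \<Longrightarrow> V p = (\<lambda>f. 0)"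
  using V by (simp add: vector_fields_def)

lemma vector_field_smooth_near: "smooth_near T A p f \<Longrightarrow> smooth_near T A p (\<lambda>q. V q f)"
  unfolding smooth_near_def using vector_field_smooth by blast

end

lemma vector_fieldsI:
  assumes "\<And>p. p \<in> topspace T \<Longrightarrow> V p \<in> tangent_space T A p"
    and "\<And>S f. openin T S \<Longrightarrow> smooth_fun_on A S f \<Longrightarrow> smooth_fun_on A S (\<lambda>p. V p f)"
    and "\<And>p. p \<notin> topspace T \<Longrightarrow> V p = (\<lambda>f. 0)"
  shows "V \<in> vector_fields T A"
  using assms by (simp add: vector_fields_def smooth_vector_field_on_def)

lemma vector_field_plus:
  assumes "V \<in> vector_fields T A" "W \<in> vector_fields T A"
  shows "(\<lambda>p f. V p f + W p f) \<in> vector_fields T A"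
  by (rule vector_fieldsI)
    (simp_all add: assms tangent_plus vector_field_tangent vector_field_smooth smooth_fun_on_add vector_field_outside)

lemma vector_field_times:
  assumes "V \<in> vector_fields T A"
  shows "(\<lambda>p f. c * V p f) \<in> vector_fields T A"
  by (rule vector_fieldsI)
    (simp_all add: assms tangent_times vector_field_tangent vector_field_smooth smooth_fun_on_mult
      smooth_fun_on_const vector_field_outside)

text \<open>In the Leibniz rule for the commutator of two derivations the mixed first-order terms cancel.\<close>

lemma lie_bracket_tangent:
  assumes V: "V \<in> vector_fields T A" and W: "W \<in> vector_fields T A"
  shows "lie_bracket T A V W p \<in> tangent_space T A p"
proof (rule tangent_spaceI)
  note tV = vector_field_tangent[OF V] and tW = vector_field_tangent[OF W]
  note sV = vector_field_smooth_near[OF V] and sW = vector_field_smooth_near[OF W]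
  fix f g c
  show "lie_bracket T A V W p f = 0" if "\<not> smooth_near T A p f"
    using that by (simp add: lie_bracket_def)
  assume f: "smooth_near T A p f"
  note ef = smooth_near_eventually[OF f]
  show "lie_bracket T A V W p (\<lambda>x. c * f x) = c * lie_bracket T A V W p f"
  proof -
    have "eventually (\<lambda>q. X q (\<lambda>x. c * f x) = c * X q f) (nhdsin T p)"
      if X: "X \<in> vector_fields T A" for X
      using ef by eventually_elim (rule tangent_scale[OF vector_field_tangent[OF X]])
    then have "V p (\<lambda>q. W q (\<lambda>x. c * f x)) = V p (\<lambda>q. c * W q f)"
      "W p (\<lambda>q. V q (\<lambda>x. c * f x)) = W p (\<lambda>q. c * V q f)"
      by (intro tangent_cong[OF tV] tangent_cong[OF tW]; simp add: V W)+
    then show ?thesis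
      using f by (simp add: lie_bracket_def smooth_near_scale tangent_scale[OF tV sW] tangent_scale[OF tW sV] algebra_simps)
  qed
  assume g: "smooth_near T A p g"
  note eg = smooth_near_eventually[OF g]
  show "lie_bracket T A V W p (\<lambda>x. f x + g x) = lie_bracket T A V W p f + lie_bracket T A V W p g"
  proof -
    have "eventually (\<lambda>q. X q (\<lambda>x. f x + g x) = X q f + X q g) (nhdsin T p)"
      if X: "X \<in> vector_fields T A" for X
      using ef eg by eventually_elim (rule tangent_add[OF vector_field_tangent[OF X]])
    then have "V p (\<lambda>q. W q (\<lambda>x. f x + g x)) = V p (\<lambda>q. W q f + W q g)"
      "W p (\<lambda>q. V q (\<lambda>x. f x + g x)) = W p (\<lambda>q. V q f + V q g)"
      by (intro tangent_cong[OF tV] tangent_cong[OF tW]; simp add: V W)+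
    then show ?thesis
      using f g by (simp add: lie_bracket_def smooth_near_add tangent_add[OF tV sW sW] tangent_add[OF tW sV sV])
  qed
  show "lie_bracket T A V W p (\<lambda>x. f x * g x) =
      lie_bracket T A V W p f * g p + f p * lie_bracket T A V W p g"
  proof -
    have "eventually (\<lambda>q. X q (\<lambda>x. f x * g x) = X q f * g q + f q * X q g) (nhdsin T p)"
      if X: "X \<in> vector_fields T A" for X
      using ef eg by eventually_elim (rule tangent_mult[OF vector_field_tangent[OF X]])
    then have "V p (\<lambda>q. W q (\<lambda>x. f x * g x)) = V p (\<lambda>q. W q f * g q + f q * W q g)"
      "W p (\<lambda>q. V q (\<lambda>x. f x * g x)) = W p (\<lambda>q. V q f * g q + f q * V q g)"
      by (intro tangent_cong[OF tV] tangent_cong[OF tW]; simp add: V W)+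
    then show ?thesis
      using f g
      by (simp add: lie_bracket_def smooth_near_mult sV sW tangent_add[OF tV] tangent_mult[OF tV]
          tangent_add[OF tW] tangent_mult[OF tW] algebra_simps)
  qed
  show "lie_bracket T A V W p f = lie_bracket T A V W p g"
    if e: "eventually (\<lambda>q. f q = g q) (nhdsin T p)"
  proof -
    have "eventually (\<lambda>q. eventually (\<lambda>x. f x = g x) (nhdsin T q)) (nhdsin T p)"
      using e unfolding eventually_nhdsin by blast
    then have "eventually (\<lambda>q. X q f = X q g) (nhdsin T p)"
      if X: "X \<in> vector_fields T A" for X
      by eventually_elim (rule tangent_cong[OF vector_field_tangent[OF X]])
    then have "V p (\<lambda>q. W q f) = V p (\<lambda>q. W q g)" "W p (\<lambda>q. V q f) = W p (\<lambda>q. V q g)"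
      by (intro tangent_cong[OF tV] tangent_cong[OF tW]; simp add: V W)+
    then show ?thesis using f g by (simp add: lie_bracket_def)
  qed
qed

lemma lie_bracket_vector_field:
  assumes V: "V \<in> vector_fields T A" and W: "W \<in> vector_fields T A"
  shows "lie_bracket T A V W \<in> vector_fields T A"
proof (rule vector_fieldsI)
  fix S f assume S: "openin T S" "smooth_fun_on A S f"
  have "smooth_fun_on A S (\<lambda>p. V p (\<lambda>q. W q f) - W p (\<lambda>q. V q f))"
    by (intro smooth_fun_on_diff[OF S(1)] vector_field_smooth[OF V S(1)] vector_field_smooth[OF W S(1)] S(2))
  then show "smooth_fun_on A S (\<lambda>p. lie_bracket T A V W p f)"
    by (rule smooth_fun_on_cong[OF S(1), rotated]) (use S in \<open>auto simp: lie_bracket_def smooth_near_def\<close>)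
next
  show "lie_bracket T A V W p = (\<lambda>f. 0)" if "p \<notin> topspace T" for p
    using that smooth_near_topspace by (auto simp: lie_bracket_def fun_eq_iff)
qed (rule lie_bracket_tangent[OF assms])

lemma lie_bracket_plus_right:
  assumes V: "V \<in> vector_fields T A" and W: "W \<in> vector_fields T A" and Z: "Z \<in> vector_fields T A"
  shows "lie_bracket T A V (\<lambda>p f. W p f + Z p f) =
    (\<lambda>p f. lie_bracket T A V W p f + lie_bracket T A V Z p f)"
  by (intro ext) (simp add: lie_bracket_def
      tangent_add[OF vector_field_tangent[OF V]] vector_field_smooth_near W Z)

lemma lie_bracket_times_right:
  assumes V: "V \<in> vector_fields T A" and W: "W \<in> vector_fields T A"
  shows "lie_bracket T A V (\<lambda>p f. c * W p f) = (\<lambda>p f. c * lie_bracket T A V W p f)"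
  by (intro ext) (simp add: lie_bracket_def
      tangent_scale[OF vector_field_tangent[OF V]] vector_field_smooth_near W algebra_simps)

end

section \<open>Left-invariant vector fields\<close>

sublocale lie_group \<subseteq> atlas_space T A
  using manifold by unfold_locales (simp add: smooth_manifold_def)

context lie_group
begin

lemma continuous_mult: "continuous_map (prod_topology T T) T (\<lambda>(x, y). x \<otimes> y)"
  using smooth_mult by (simp add: smooth_map_def)

lemma left_translation_preimage_open:
  assumes "a \<in> carrier G" "openin T S"
  shows "openin T {x \<in> carrier G. a \<otimes> x \<in> S}"
proof -
  have "continuous_map T (prod_topology T T) (\<lambda>x. (a, x))"
    using assms(1) by (simp add: continuous_map_pairedI topspace_eq)
  from continuous_map_compose[OF this continuous_mult]
  have "continuous_map T T (\<lambda>x. a \<otimes> x)" by (simp add: o_def)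
  from openin_continuous_map_preimage[OF this assms(2)] show ?thesis by (simp add: topspace_eq)
qed

text \<open>In charts, left translation by \<open>a\<close> is the multiplication composed with the affine map
  \<open>e \<mapsto> (\<phi>0 a, e)\<close> onto a slice of the product chart.\<close>

lemma left_translation_smooth:
  assumes a: "a \<in> carrier G" and c: "(U, \<phi>) \<in> A" and d: "(W, \<psi>) \<in> A"
  shows "Ck_on k (\<phi> ` {x \<in> U. a \<otimes> x \<in> W}) (\<lambda>e. \<psi> (a \<otimes> inv_into U \<phi> e))"
proof -
  obtain U0 \<phi>0 where c0: "(U0, \<phi>0) \<in> A" "a \<in> U0"
    using chart_around[of a] a topspace_eq by auto
  have UG: "U \<subseteq> carrier G" using openin_subset[OF chart_domain_open[OF c]] topspace_eq by simp
  let ?m = "\<lambda>(x, y). x \<otimes> y"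
  let ?\<chi> = "map_prod \<phi>0 \<phi>"
  define D where "D = {z \<in> U0 \<times> U. ?m z \<in> W}"
  define S where "S = \<phi> ` {x \<in> U. a \<otimes> x \<in> W}"
  have "{x \<in> U. a \<otimes> x \<in> W} = U \<inter> {x \<in> carrier G. a \<otimes> x \<in> W}" using UG by auto
  then have S: "open S"
    unfolding S_def
    using chart_image_open[OF c left_translation_preimage_open[OF a chart_domain_open[OF d]]] by simp
  have "openin (prod_topology T T) ({z \<in> topspace (prod_topology T T). ?m z \<in> W} \<inter> U0 \<times> U)"
    by (intro openin_Int openin_continuous_map_preimage[OF continuous_mult] chart_domain_open[OF d])
      (simp add: openin_prod_Times_iff chart_domain_open[OF c] chart_domain_open[OF c0(1)])
  moreover have "{z \<in> topspace (prod_topology T T). ?m z \<in> W} \<inter> U0 \<times> U = D"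
    using openin_subset[OF chart_domain_open[OF c]] openin_subset[OF chart_domain_open[OF c0(1)]]
    by (auto simp: D_def)
  ultimately have D: "open (?\<chi> ` D)"
    using prod_chart_image_open[OF c0(1) c, of D] by (auto simp: D_def)
  have inv: "inv_into (U0 \<times> U) ?\<chi> (\<phi>0 x, \<phi> y) = (x, y)" if "x \<in> U0" "y \<in> U" for x y
    using inv_into_f_f[OF map_prod_inj_on[OF chart_inj[OF c0(1)] chart_inj[OF c]], of "(x, y)"] that
    by simp
  have "(U0 \<times> U, ?\<chi>) \<in> prod_atlas A A" using c c0 unfolding prod_atlas_def by blast
  then have "Ck_on k (?\<chi> ` D) (\<psi> \<circ> ?m \<circ> inv_into (U0 \<times> U) ?\<chi>)"
    using smooth_mult d unfolding smooth_map_def smooth_on_def D_def by fast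
  moreover have "(\<lambda>e. (\<phi>0 a, e)) ` S \<subseteq> ?\<chi> ` D"
    using c0(2) by (force simp: S_def D_def)
  ultimately have "Ck_on k S (\<lambda>e. (\<psi> \<circ> ?m \<circ> inv_into (U0 \<times> U) ?\<chi>) (\<phi>0 a, e))"
    by (rule Ck_on_compose[OF S D _ Ck_on_Pair_const[OF S], rotated])
  then have "Ck_on k S (\<lambda>e. \<psi> (a \<otimes> inv_into U \<phi> e))"
  proof (rule Ck_on_cong[OF S, rotated])
    fix e assume "e \<in> S"
    then obtain x where "x \<in> U" "e = \<phi> x" by (auto simp: S_def)
    then show "(\<psi> \<circ> ?m \<circ> inv_into (U0 \<times> U) ?\<chi>) (\<phi>0 a, e) = \<psi> (a \<otimes> inv_into U \<phi> e)"
      using inv[OF c0(2)] inv_into_f_f[OF chart_inj[OF c]] by simp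
  qed
  then show ?thesis by (simp add: S_def)
qed

lemma smooth_fun_on_left_translate:
  assumes a: "a \<in> carrier G" and S: "openin T S" and f: "smooth_fun_on A S f"
  shows "smooth_fun_on A {x \<in> carrier G. a \<otimes> x \<in> S} (\<lambda>x. f (a \<otimes> x))"
proof (rule smooth_fun_onI, rule Ck_on_local)
  fix U \<phi> k e assume c: "(U, \<phi>) \<in> A" and "e \<in> \<phi> ` (U \<inter> {x \<in> carrier G. a \<otimes> x \<in> S})"
  then obtain x where x: "x \<in> U" "x \<in> carrier G" "a \<otimes> x \<in> S" "e = \<phi> x" by auto
  obtain W \<psi> where d: "(W, \<psi>) \<in> A" "a \<otimes> x \<in> W"
    using chart_around[of "a \<otimes> x"] a x(2) topspace_eq by auto
  let ?M = "\<phi> ` (U \<inter> {x \<in> carrier G. a \<otimes> x \<in> W \<inter> S})"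
  have WS: "openin T (W \<inter> S)" using chart_domain_open[OF d(1)] S by (rule openin_Int)
  have M: "open ?M"
    by (rule chart_image_open[OF c left_translation_preimage_open[OF a WS]])
  have "Ck_on k ?M (\<lambda>e. f (inv_into W \<psi> (\<psi> (a \<otimes> inv_into U \<phi> e))))"
  proof (rule Ck_on_compose[OF M chart_image_open[OF d(1) S]])
    show "(\<lambda>e. \<psi> (a \<otimes> inv_into U \<phi> e)) ` ?M \<subseteq> \<psi> ` (W \<inter> S)"
      using inv_into_f_f[OF chart_inj[OF c]] by auto
    show "Ck_on k ?M (\<lambda>e. \<psi> (a \<otimes> inv_into U \<phi> e))"
      by (rule Ck_on_subset[OF left_translation_smooth[OF a c d(1)]]) auto
    show "Ck_on k (\<psi> ` (W \<inter> S)) (\<lambda>e. f (inv_into W \<psi> e))"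
      by (rule smooth_fun_onD[OF f d(1)])
  qed
  then have "Ck_on k ?M (\<lambda>e. f (a \<otimes> inv_into U \<phi> e))"
    by (rule Ck_on_cong[OF M, rotated])
      (auto simp: inv_into_f_f[OF chart_inj[OF c]] inv_into_f_f[OF chart_inj[OF d(1)]])
  then show "\<exists>N. open N \<and> e \<in> N \<and> Ck_on k N (\<lambda>e. f (a \<otimes> inv_into U \<phi> e))"
    using M x d(2) by (intro exI[of _ ?M]) auto
qed

lemma smooth_near_left_translateI:
  assumes "a \<in> carrier G" "p \<in> carrier G" "smooth_near T A (a \<otimes> p) f"
  shows "smooth_near T A p (\<lambda>x. f (a \<otimes> x))"
proof -
  obtain S where S: "openin T S" "a \<otimes> p \<in> S" "smooth_fun_on A S f"
    using assms(3) unfolding smooth_near_def by blast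
  show ?thesis
    by (rule smooth_nearI[OF left_translation_preimage_open[OF assms(1) S(1)] _
          smooth_fun_on_left_translate[OF assms(1) S(1,3)]]) (use assms(2) S(2) in simp)
qed

lemma eventually_carrier:
  assumes "\<And>x. x \<in> carrier G \<Longrightarrow> P x"
  shows "eventually P (nhdsin T p)"
  unfolding eventually_nhdsin using assms topspace_eq openin_topspace by metis

text \<open>Both directions matter: a tangent vector is \<open>0\<close> on functions that are not smooth nearby, so
  left-invariance of a bracket has to be checked on those functions as well. The converse
  direction translates back by \<open>inv a\<close>.\<close>

lemma smooth_near_left_translate_iff:
  assumes a: "a \<in> carrier G" and p: "p \<in> carrier G"
  shows "smooth_near T A p (\<lambda>x. f (a \<otimes> x)) \<longleftrightarrow> smooth_near T A (a \<otimes> p) f"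
proof
  assume s: "smooth_near T A p (\<lambda>x. f (a \<otimes> x))"
  have "smooth_near T A (a \<otimes> p) (\<lambda>x. f (a \<otimes> (inv a \<otimes> x)))"
    by (rule smooth_near_left_translateI[of "inv a" "a \<otimes> p" "\<lambda>x. f (a \<otimes> x)"])
      (use s a p in \<open>simp_all add: m_assoc[symmetric]\<close>)
  then show "smooth_near T A (a \<otimes> p) f"
    by (rule smooth_near_cong[rotated])
      (rule eventually_carrier, use a in \<open>simp add: m_assoc[symmetric]\<close>)
qed (rule smooth_near_left_translateI[OF a p])

abbreviation \<gg> :: "('a \<Rightarrow> 'a tangent) set"
  where "\<gg> \<equiv> lie_algebra G T A"

lemma lie_algebra_vector_field: "V \<in> \<gg> \<Longrightarrow> V \<in> vector_fields T A"
  by (simp add: lie_algebra_def)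

lemma lie_algebra_translate:
  "V \<in> \<gg> \<Longrightarrow> a \<in> carrier G \<Longrightarrow> p \<in> carrier G \<Longrightarrow> V (a \<otimes> p) f = V p (\<lambda>x. f (a \<otimes> x))"
  by (simp add: lie_algebra_def left_push_def)

lemma lie_algebraI:
  assumes "V \<in> vector_fields T A"
    and "\<And>a p f. a \<in> carrier G \<Longrightarrow> p \<in> carrier G \<Longrightarrow> V (a \<otimes> p) f = V p (\<lambda>x. f (a \<otimes> x))"
  shows "V \<in> \<gg>"
  using assms by (auto simp: lie_algebra_def left_push_def)

lemma lie_algebra_tangent: "V \<in> \<gg> \<Longrightarrow> V p \<in> tangent_space T A p"
  using vector_field_tangent lie_algebra_vector_field by blast

lemma lie_algebra_plus: "V \<in> \<gg> \<Longrightarrow> W \<in> \<gg> \<Longrightarrow> (\<lambda>p f. V p f + W p f) \<in> \<gg>"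
  by (rule lie_algebraI) (simp_all add: vector_field_plus lie_algebra_vector_field lie_algebra_translate)

lemma lie_algebra_times: "V \<in> \<gg> \<Longrightarrow> (\<lambda>p f. c * V p f) \<in> \<gg>"
  by (rule lie_algebraI) (simp_all add: vector_field_times lie_algebra_vector_field lie_algebra_translate)

lemma lie_algebra_zero: "(\<lambda>p f. 0) \<in> \<gg>"
  by (rule lie_algebraI) (auto intro!: vector_fieldsI tangent_zero smooth_fun_on_const)

text \<open>Applying the invariance of both fields to \<open>X (a \<otimes> p) (\<lambda>q. Y q f)\<close> moves the translation past each
  of them. For the inner field this is an identity between functions on \<open>G\<close> only, hence between
  germs, which is all that \<open>X p\<close> depends on.\<close>

lemma lie_algebra_bracket:
  assumes V: "V \<in> \<gg>" and W: "W \<in> \<gg>"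
  shows "lie_bracket T A V W \<in> \<gg>"
proof (rule lie_algebraI)
  show "lie_bracket T A V W \<in> vector_fields T A"
    using assms by (intro lie_bracket_vector_field lie_algebra_vector_field)
  fix a p f assume a: "a \<in> carrier G" and p: "p \<in> carrier G"
  have swap: "X (a \<otimes> p) (\<lambda>q. Y q f) = X p (\<lambda>q. Y q (\<lambda>x. f (a \<otimes> x)))"
    if X: "X \<in> \<gg>" and Y: "Y \<in> \<gg>" for X Y
  proof -
    have "X (a \<otimes> p) (\<lambda>q. Y q f) = X p (\<lambda>q. Y (a \<otimes> q) f)"
      by (rule lie_algebra_translate[OF X a p])
    also have "\<dots> = X p (\<lambda>q. Y q (\<lambda>x. f (a \<otimes> x)))"
      by (rule tangent_cong[OF lie_algebra_tangent[OF X]], rule eventually_carrier)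
        (rule lie_algebra_translate[OF Y a])
    finally show ?thesis .
  qed
  show "lie_bracket T A V W (a \<otimes> p) f = lie_bracket T A V W p (\<lambda>x. f (a \<otimes> x))"
    by (simp add: lie_bracket_def smooth_near_left_translate_iff[OF a p] swap[OF V W] swap[OF W V])
qed

lemma lie_algebra_eqI:
  assumes V: "V \<in> \<gg>" and W: "W \<in> \<gg>" and one: "V \<one> = W \<one>"
  shows "V = W"
proof
  fix p
  show "V p = W p"
  proof (cases "p \<in> carrier G")
    case True
    show ?thesis
      using lie_algebra_translate[OF V True one_closed] lie_algebra_translate[OF W True one_closed] one True
      by (intro ext) simp
  next
    case False
    then show ?thesis
      using vector_field_outside lie_algebra_vector_field V W topspace_eq by metis
  qed
qed

text \<open>Since a left-invariant field is determined by its value at the identity, the coordinates of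
  that value embed the Lie algebra linearly in the model space. This is its finite-dimensionality,
  in the form used below.\<close>

lemma lie_algebra_embedding:
  obtains \<Phi> :: "('a \<Rightarrow> 'a tangent) \<Rightarrow> 'e" where
    "\<And>V W. \<Phi> (\<lambda>p f. V p f + W p f) = \<Phi> V + \<Phi> W"
    "\<And>V c. \<Phi> (\<lambda>p f. c * V p f) = c *\<^sub>R \<Phi> V"
    "inj_on \<Phi> \<gg>"
proof -
  obtain U \<phi> where c: "(U, \<phi>) \<in> A" "\<one> \<in> U"
    using chart_around[of \<one>] topspace_eq by auto
  define \<Phi> where "\<Phi> V = (\<Sum>b\<in>Basis. V \<one> (coordinate \<phi> \<one> b) *\<^sub>R b)" for V :: "'a \<Rightarrow> 'a tangent"
  have plus: "\<Phi> (\<lambda>p f. V p f + W p f) = \<Phi> V + \<Phi> W" for V W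
    by (simp add: \<Phi>_def scaleR_add_left sum.distrib)
  have times: "\<Phi> (\<lambda>p f. c * V p f) = c *\<^sub>R \<Phi> V" for V c
    by (simp add: \<Phi>_def scaleR_sum_right)
  have "inj_on \<Phi> \<gg>"
  proof (rule inj_onI)
    fix V W assume V: "V \<in> \<gg>" and W: "W \<in> \<gg>" and eq: "\<Phi> V = \<Phi> W"
    define D where "D = (\<lambda>p f. V p f + (-1) * W p f)"
    have D: "D \<in> \<gg>" unfolding D_def by (rule lie_algebra_plus[OF V lie_algebra_times[OF W]])
    have "\<Phi> D = 0" using plus[of V "\<lambda>p f. (-1) * W p f"] times[of "-1" W] eq by (simp add: D_def)
    then have "D \<one> (coordinate \<phi> \<one> b) = 0" if "b \<in> Basis" for b
      using inner_sum_left_Basis[OF that, of "\<lambda>b. D \<one> (coordinate \<phi> \<one> b)"] by (simp add: \<Phi>_def)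
    then have "D \<one> = (\<lambda>f. 0)"
      by (rule tangent_eq_zeroI[OF c lie_algebra_tangent[OF D]])
    then show "V = W"
      by (intro lie_algebra_eqI[OF V W] ext) (simp add: D_def fun_eq_iff)
  qed
  with plus times show ?thesis by (rule that)
qed

end

section \<open>Representing linear functionals on the Lie algebra\<close>

text \<open>The Riesz representation on a subspace of a Euclidean space, for an inner product unrelated
  to the ambient one. One Gram--Schmidt step: if \<open>a\<close> is a new generator and \<open>w\<close> represents
  \<open>B a\<close> on the previous span, then \<open>a - w\<close> is orthogonal to that span, and a multiple of it corrects the
  representing vector.\<close>

lemma riesz_subspace:
  fixes L :: "'e::euclidean_space set" and B :: "'e \<Rightarrow> 'e \<Rightarrow> real" and l :: "'e \<Rightarrow> real"
  assumes L: "subspace L"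
    and sym: "\<And>x y. x \<in> L \<Longrightarrow> y \<in> L \<Longrightarrow> B x y = B y x"
    and plus: "\<And>x y z. x \<in> L \<Longrightarrow> y \<in> L \<Longrightarrow> z \<in> L \<Longrightarrow> B (x + y) z = B x z + B y z"
    and times: "\<And>c x y. x \<in> L \<Longrightarrow> y \<in> L \<Longrightarrow> B (c *\<^sub>R x) y = c * B x y"
    and pos: "\<And>x. x \<in> L \<Longrightarrow> x \<noteq> 0 \<Longrightarrow> B x x > 0"
    and l_plus: "\<And>x y. x \<in> L \<Longrightarrow> y \<in> L \<Longrightarrow> l (x + y) = l x + l y"
    and l_times: "\<And>c x. x \<in> L \<Longrightarrow> l (c *\<^sub>R x) = c * l x"
  shows "\<exists>u\<in>L. \<forall>y\<in>L. B u y = l y"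
proof -
  have plus': "B x (y + z) = B x y + B x z" if "x \<in> L" "y \<in> L" "z \<in> L" for x y z
    using that plus[of y z x] sym subspace_add[OF L] by metis
  have times': "B x (c *\<^sub>R y) = c * B x y" if "x \<in> L" "y \<in> L" for x y c
    using that times[of y x c] sym subspace_scale[OF L] by metis
  have "\<exists>u\<in>span F. \<forall>y\<in>span F. B u y = l y"
    if "finite F" "F \<subseteq> L" "\<And>x y. x \<in> L \<Longrightarrow> y \<in> L \<Longrightarrow> l (x + y) = l x + l y"
      "\<And>c x. x \<in> L \<Longrightarrow> l (c *\<^sub>R x) = c * l x" for F and l :: "'e \<Rightarrow> real"
    using that
  proof (induction F arbitrary: l rule: finite_induct)
    case empty
    have "(0::'e) \<in> L" using subspace_0[OF L] .
    then have "B 0 0 = 0" "l 0 = 0" using times[of 0 0 0] empty.prems(3)[of 0 0] by auto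
    then show ?case by simp
  next
    case (insert a F l)
    have FL: "F \<subseteq> L" and a: "a \<in> L" using insert.prems by auto
    have spanL: "x \<in> L" if "x \<in> span F" for x using span_minimal[OF FL L] that by blast
    obtain u where u: "u \<in> span F" "\<And>y. y \<in> span F \<Longrightarrow> B u y = l y"
      using insert.IH[OF FL insert.prems(2,3)] by blast
    obtain w where w: "w \<in> span F" "\<And>y. y \<in> span F \<Longrightarrow> B w y = B a y"
      using insert.IH[OF FL plus'[OF a] times'[OF a]] by blast
    define d where "d = a + (-1) *\<^sub>R w"
    have d: "d \<in> L" unfolding d_def using a spanL[OF w(1)] L by (intro subspace_add subspace_scale)
    have orth: "B d y = 0" if "y \<in> span F" for y
      using plus[OF a subspace_scale[OF L spanL[OF w(1)]] spanL[OF that], of "-1"]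
        times[OF spanL[OF w(1)] spanL[OF that], of "-1"] w(2)[OF that] by (simp add: d_def)
    \<comment> \<open>If \<open>d = 0\<close>, the new generator adds nothing to the span, and \<open>k\<close> has the default value \<open>0\<close>.\<close>
    define k where "k = (l d - B u d) / B d d"
    have "k * B d d = l d - B u d"
    proof (cases "d = 0")
      case True
      have "B x (0 *\<^sub>R d) = 0 * B x d" "l (0 *\<^sub>R d) = 0 * l d" if "x \<in> L" for x
        using times'[OF that d, of 0] insert.prems(3)[OF d, of 0] by simp_all
      then show ?thesis using True spanL[OF u(1)] d by simp
    qed (use pos[OF d] in \<open>simp add: k_def\<close>)
    moreover have "B u d = 0" using orth[OF u(1)] sym[OF d spanL[OF u(1)]] by simp
    ultimately have k: "k * B d d = l d" by simp
    have w': "w \<in> span (insert a F)" and u': "u \<in> span (insert a F)"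
      using w(1) u(1) span_mono[of F "insert a F"] by auto
    have d': "d \<in> span (insert a F)"
      unfolding d_def using w' by (intro span_add span_scale) (simp_all add: span_base)
    show ?case
    proof (intro bexI ballI)
      show "u + k *\<^sub>R d \<in> span (insert a F)" using u' d' by (intro span_add span_scale)
      fix y assume "y \<in> span (insert a F)"
      then obtain m where m: "y - m *\<^sub>R a \<in> span F" unfolding span_breakdown_eq by blast
      define z where "z = (y - m *\<^sub>R a) + m *\<^sub>R w"
      have z: "z \<in> span F" unfolding z_def using m w(1) by (intro span_add span_scale)
      have y: "y = z + m *\<^sub>R d" by (simp add: z_def d_def algebra_simps)
      have L': "u \<in> L" "z \<in> L" "k *\<^sub>R d \<in> L" "m *\<^sub>R d \<in> L" "u + k *\<^sub>R d \<in> L"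
        using spanL u(1) z d L by (auto intro: subspace_add subspace_scale)
      have "B (u + k *\<^sub>R d) y = B u z + k * B d z + m * (B u d + k * B d d)"
        unfolding y using L' d by (simp add: plus' times' plus times)
      also have "\<dots> = l z + m * l d"
        using u(2)[OF z] orth[OF z] k \<open>B u d = 0\<close> by simp
      also have "\<dots> = l y"
        unfolding y using L' d insert.prems(2,3) by simp
      finally show "B (u + k *\<^sub>R d) y = l y" .
    qed
  qed
  moreover obtain F where F: "F \<subseteq> L" "independent F" "span F = L"
    using basis_exists[of L] L by (metis span_eq_iff span_minimal subset_antisym)
  ultimately show ?thesis
    using l_plus l_times independent_imp_finite[OF F(2)] F by metis
qed

locale lie_group_metric = lie_group G T A
  for G :: "('a, 'b) monoid_scheme" (structure) and T :: "'a topology"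
    and A :: "('a, 'e::euclidean_space) chart set" +
  fixes h :: "'a \<Rightarrow> 'a tangent \<Rightarrow> 'a tangent \<Rightarrow> real"
  assumes metric: "riemannian_metric T A h"
begin

abbreviation inner_\<gg> (\<open>\<langle>_, _\<rangle>\<close>) where "\<langle>v, w\<rangle> \<equiv> induced_inner G h v w"
abbreviation bracket where "bracket \<equiv> lie_bracket T A"

lemma one_topspace: "\<one> \<in> topspace T"
  by (simp add: topspace_eq)

lemma
  assumes "r \<in> tangent_space T A \<one>" "s \<in> tangent_space T A \<one>"
  shows metric_sym: "h \<one> r s = h \<one> s r"
    and metric_times: "h \<one> (\<lambda>f. c * r f) s = c * h \<one> r s"
    and metric_plus: "t \<in> tangent_space T A \<one> \<Longrightarrow> h \<one> (\<lambda>f. r f + s f) t = h \<one> r t + h \<one> s t"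
  using metric assms one_topspace unfolding riemannian_metric_def by blast+

lemma metric_pos: "r \<in> tangent_space T A \<one> \<Longrightarrow> r \<noteq> (\<lambda>f. 0) \<Longrightarrow> h \<one> r r > 0"
  using metric one_topspace unfolding riemannian_metric_def by blast

lemma inner_sym: "v \<in> \<gg> \<Longrightarrow> w \<in> \<gg> \<Longrightarrow> \<langle>v, w\<rangle> = \<langle>w, v\<rangle>"
  unfolding induced_inner_def by (rule metric_sym; rule lie_algebra_tangent)

lemma inner_times: "v \<in> \<gg> \<Longrightarrow> w \<in> \<gg> \<Longrightarrow> \<langle>\<lambda>p f. c * v p f, w\<rangle> = c * \<langle>v, w\<rangle>"
  unfolding induced_inner_def by (rule metric_times; rule lie_algebra_tangent)

lemma inner_plus:
  "u \<in> \<gg> \<Longrightarrow> v \<in> \<gg> \<Longrightarrow> w \<in> \<gg> \<Longrightarrow> \<langle>\<lambda>p f. u p f + v p f, w\<rangle> = \<langle>u, w\<rangle> + \<langle>v, w\<rangle>"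
  unfolding induced_inner_def by (rule metric_plus; rule lie_algebra_tangent)

lemma inner_pos:
  assumes "v \<in> \<gg>" "v \<noteq> (\<lambda>p f. 0)"
  shows "\<langle>v, v\<rangle> > 0"
proof -
  have "v \<one> \<noteq> (\<lambda>f. 0)"
    using lie_algebra_eqI[OF assms(1) lie_algebra_zero] assms(2) by blast
  then show ?thesis
    unfolding induced_inner_def by (intro metric_pos lie_algebra_tangent assms(1))
qed

lemma inner_times_right: "v \<in> \<gg> \<Longrightarrow> w \<in> \<gg> \<Longrightarrow> \<langle>v, \<lambda>p f. c * w p f\<rangle> = c * \<langle>v, w\<rangle>"
  by (simp add: inner_sym[of v] inner_times lie_algebra_times)

lemma inner_plus_right:
  "u \<in> \<gg> \<Longrightarrow> v \<in> \<gg> \<Longrightarrow> w \<in> \<gg> \<Longrightarrow> \<langle>u, \<lambda>p f. v p f + w p f\<rangle> = \<langle>u, v\<rangle> + \<langle>u, w\<rangle>"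
  by (simp add: inner_sym[of u] inner_plus lie_algebra_plus)

lemma inner_nondegenerate:
  assumes u: "u \<in> \<gg>" and v: "v \<in> \<gg>" and eq: "\<And>y. y \<in> \<gg> \<Longrightarrow> \<langle>u, y\<rangle> = \<langle>v, y\<rangle>"
  shows "u = v"
proof -
  define d where "d = (\<lambda>p f. u p f + (-1) * v p f)"
  have d: "d \<in> \<gg>" unfolding d_def by (rule lie_algebra_plus[OF u lie_algebra_times[OF v]])
  have "\<langle>d, d\<rangle> = \<langle>u, d\<rangle> + (-1) * \<langle>v, d\<rangle>"
    unfolding d_def using d[unfolded d_def] u v
    by (simp only: inner_plus inner_times lie_algebra_times)
  then have "\<langle>d, d\<rangle> = 0" using eq[OF d] by simp
  then have "d = (\<lambda>p f. 0)" using inner_pos[OF d] by fastforce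
  then show ?thesis by (simp add: d_def fun_eq_iff)
qed

text \<open>The embedding in the model space carries the Riesz representation over to the Lie algebra.\<close>

lemma lie_algebra_riesz:
  fixes l :: "('a \<Rightarrow> 'a tangent) \<Rightarrow> real"
  assumes l_plus: "\<And>v w. v \<in> \<gg> \<Longrightarrow> w \<in> \<gg> \<Longrightarrow> l (\<lambda>p f. v p f + w p f) = l v + l w"
    and l_times: "\<And>c v. v \<in> \<gg> \<Longrightarrow> l (\<lambda>p f. c * v p f) = c * l v"
  shows "\<exists>u\<in>\<gg>. \<forall>y\<in>\<gg>. \<langle>u, y\<rangle> = l y"
proof -
  obtain \<Phi> :: "('a \<Rightarrow> 'a tangent) \<Rightarrow> 'e" where
    plus: "\<And>V W. \<Phi> (\<lambda>p f. V p f + W p f) = \<Phi> V + \<Phi> W" and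
    times: "\<And>V c. \<Phi> (\<lambda>p f. c * V p f) = c *\<^sub>R \<Phi> V" and
    inj: "inj_on \<Phi> \<gg>"
    by (rule lie_algebra_embedding) (rule that)
  define \<Psi> where "\<Psi> = inv_into \<gg> \<Phi>"
  have \<Psi>: "\<Psi> (\<Phi> V) = V" if "V \<in> \<gg>" for V unfolding \<Psi>_def by (rule inv_into_f_f[OF inj that])
  have \<Psi>_mem: "\<Psi> x \<in> \<gg>" if "x \<in> \<Phi> ` \<gg>" for x unfolding \<Psi>_def using inv_into_into that by metis
  have \<Psi>_plus: "\<Psi> (x + y) = (\<lambda>p f. \<Psi> x p f + \<Psi> y p f)" if "x \<in> \<Phi> ` \<gg>" "y \<in> \<Phi> ` \<gg>" for x y
    using that \<Psi> lie_algebra_plus by (auto simp: plus[symmetric])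
  have \<Psi>_times: "\<Psi> (c *\<^sub>R x) = (\<lambda>p f. c * \<Psi> x p f)" if "x \<in> \<Phi> ` \<gg>" for x c
    using that \<Psi> lie_algebra_times by (auto simp: times[symmetric])
  have zero: "\<Phi> (\<lambda>p f. 0) = 0" using times[of 0 "\<lambda>p f. 0"] by simp
  have "\<exists>u\<in>\<Phi> ` \<gg>. \<forall>y\<in>\<Phi> ` \<gg>. \<langle>\<Psi> u, \<Psi> y\<rangle> = l (\<Psi> y)"
  proof (rule riesz_subspace)
    show "subspace (\<Phi> ` \<gg>)"
    proof (rule subspaceI)
      show "0 \<in> \<Phi> ` \<gg>" using zero lie_algebra_zero by (metis imageI)
      show "x + y \<in> \<Phi> ` \<gg>" if "x \<in> \<Phi> ` \<gg>" "y \<in> \<Phi> ` \<gg>" for x y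
        using that lie_algebra_plus by (auto simp: plus[symmetric])
      show "c *\<^sub>R x \<in> \<Phi> ` \<gg>" if "x \<in> \<Phi> ` \<gg>" for x c
        using that lie_algebra_times by (auto simp: times[symmetric])
    qed
    show "\<langle>\<Psi> x, \<Psi> x\<rangle> > 0" if "x \<in> \<Phi> ` \<gg>" "x \<noteq> 0" for x
      using that zero \<Psi> by (intro inner_pos \<Psi>_mem) auto
  qed (simp_all add: \<Psi>_plus \<Psi>_times \<Psi>_mem inner_plus inner_times l_plus l_times inner_sym)
  then obtain u where u: "u \<in> \<Phi> ` \<gg>" "\<And>y. y \<in> \<Phi> ` \<gg> \<Longrightarrow> \<langle>\<Psi> u, \<Psi> y\<rangle> = l (\<Psi> y)" by blast
  show ?thesis
  proof (intro bexI ballI)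
    show "\<langle>\<Psi> u, y\<rangle> = l y" if "y \<in> \<gg>" for y using u(2)[of "\<Phi> y"] that \<Psi> by simp
  qed (rule \<Psi>_mem[OF u(1)])
qed

text \<open>The transpose is given by a definite description, so reading off anything from it
  requires existence and uniqueness of the representing vector; then it vanishes iff the functional
  that it represents does.\<close>

lemma ad_transpose_eq_zero_iff:
  assumes v: "v \<in> \<gg>" and w: "w \<in> \<gg>"
  shows "ad_transpose G T A h v w = (\<lambda>p f. 0) \<longleftrightarrow> (\<forall>y\<in>\<gg>. \<langle>w, bracket v y\<rangle> = 0)"
proof -
  note vf = lie_algebra_vector_field
  have "\<exists>u\<in>\<gg>. \<forall>y\<in>\<gg>. \<langle>u, y\<rangle> = \<langle>w, bracket v y\<rangle>"
    by (rule lie_algebra_riesz)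
      (simp_all add: lie_bracket_plus_right lie_bracket_times_right vf v w
        inner_plus_right inner_times_right lie_algebra_bracket)
  then obtain u where u: "u \<in> \<gg>" "\<forall>y\<in>\<gg>. \<langle>u, y\<rangle> = \<langle>w, bracket v y\<rangle>" by blast
  have "ad_transpose G T A h v w = u"
    unfolding ad_transpose_def using u by (intro the_equality conjI inner_nondegenerate) auto
  moreover have "u = (\<lambda>p f. 0) \<longleftrightarrow> (\<forall>y\<in>\<gg>. \<langle>u, y\<rangle> = 0)"
    using inner_times[OF lie_algebra_zero, of _ 0] inner_pos[OF u(1)] u(1) by fastforce
  ultimately show ?thesis using u(2) by simp
qed

end

section \<open>Geodesic and Killing vectors of the deformed metric\<close>

theorem proposition2p4:
  fixes G :: "('a, 'b) monoid_scheme"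
    and T :: "'a topology"
    and A :: "('a, 'e::euclidean_space) chart set"
    and h gX :: "'a \<Rightarrow> 'a tangent \<Rightarrow> 'a tangent \<Rightarrow> real"
    and X v :: "'a \<Rightarrow> 'a tangent"
  assumes "lie_group G T A"
    and "left_invariant_metric G T A h"
    and "X \<in> lie_algebra G T A" and "X \<noteq> (\<lambda>p f. 0)" and "induced_norm G h X < 1"
    and "left_invariant_metric G T A gX"
    and "\<And>u z. u \<in> lie_algebra G T A \<Longrightarrow> z \<in> lie_algebra G T A \<Longrightarrow>
           induced_inner G gX u z =
             (1 + induced_norm G h X) *
               (induced_inner G h u z +
                1 / induced_norm G h X * induced_inner G h X u * induced_inner G h X z)"
    and "v \<in> lie_algebra G T A"
  shows "(geodesic_vector G T A h v \<longrightarrow>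
           (geodesic_vector G T A gX v \<longleftrightarrow>
              ad_transpose G T A h v X = (\<lambda>p f. 0) \<or> induced_inner G h X v = 0)) \<and>
         (killing_vector G T A h v \<longrightarrow>
           (killing_vector G T A gX v \<longleftrightarrow> ad_transpose G T A h v X = (\<lambda>p f. 0)))"
proof -
  interpret lie_group_metric G T A h
    using assms(1,2) by (simp add: lie_group_metric_def lie_group_metric_axioms_def left_invariant_metric_def)
  note X = assms(3) and v = assms(8)
  define n where "n = induced_norm G h X"
  have XX: "\<langle>X, X\<rangle> > 0" using inner_pos X assms(4) .
  then have n: "n > 0" by (simp add: n_def induced_norm_def)
  note br = lie_algebra_bracket[OF v]
  have gX: "induced_inner G gX u z = (1 + n) * (\<langle>u, z\<rangle> + \<langle>X, u\<rangle> * \<langle>X, z\<rangle> / n)"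
    if "u \<in> \<gg>" "z \<in> \<gg>" for u z
    using assms(7)[OF that] by (simp add: n_def)
  note ad = ad_transpose_eq_zero_iff[OF v X]
  show ?thesis
  proof (intro conjI impI)
    assume "geodesic_vector G T A h v"
    then have "induced_inner G gX v (bracket v y) = (1 + n) / n * (\<langle>X, v\<rangle> * \<langle>X, bracket v y\<rangle>)" if "y \<in> \<gg>" for y
      using gX[OF v br[OF that]] that by (simp add: geodesic_vector_def)
    then have "geodesic_vector G T A gX v \<longleftrightarrow> (\<forall>y\<in>\<gg>. \<langle>X, v\<rangle> * \<langle>X, bracket v y\<rangle> = 0)"
      using n by (simp add: geodesic_vector_def)
    then show "geodesic_vector G T A gX v \<longleftrightarrow> ad_transpose G T A h v X = (\<lambda>p f. 0) \<or> \<langle>X, v\<rangle> = 0"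
      unfolding ad by auto
  next
    assume K: "killing_vector G T A h v"
    have "induced_inner G gX (bracket v y) z + induced_inner G gX y (bracket v z) =
        (1 + n) / n * (\<langle>X, bracket v y\<rangle> * \<langle>X, z\<rangle> + \<langle>X, y\<rangle> * \<langle>X, bracket v z\<rangle>)"
      if y: "y \<in> \<gg>" and z: "z \<in> \<gg>" for y z
    proof -
      have "\<langle>bracket v y, z\<rangle> + \<langle>y, bracket v z\<rangle> = 0" using K y z by (simp add: killing_vector_def)
      then have "\<langle>bracket v y, z\<rangle> = - \<langle>y, bracket v z\<rangle>" by simp
      then show ?thesis
        using n by (simp add: gX[OF br[OF y] z] gX[OF y br[OF z]] field_simps)
    qed
    then have kill: "killing_vector G T A gX v \<longleftrightarrow>
        (\<forall>y\<in>\<gg>. \<forall>z\<in>\<gg>. \<langle>X, bracket v y\<rangle> * \<langle>X, z\<rangle> + \<langle>X, y\<rangle> * \<langle>X, bracket v z\<rangle> = 0)"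
      using n by (simp add: killing_vector_def)
    show "killing_vector G T A gX v \<longleftrightarrow> ad_transpose G T A h v X = (\<lambda>p f. 0)"
      unfolding ad
    proof
      assume "killing_vector G T A gX v"
      then have eq: "\<langle>X, bracket v y\<rangle> * \<langle>X, z\<rangle> + \<langle>X, y\<rangle> * \<langle>X, bracket v z\<rangle> = 0" if "y \<in> \<gg>" "z \<in> \<gg>" for y z
        using kill that by blast
      \<comment> \<open>The two terms coincide at \<open>y = z = X\<close>; afterwards \<open>z = X\<close> isolates the first term.\<close>
      have "\<langle>X, bracket v X\<rangle> = 0" using eq[OF X X] XX by simp
      then show "\<forall>y\<in>\<gg>. \<langle>X, bracket v y\<rangle> = 0" using eq[OF _ X] XX by simp
    qed (simp add: kill)
  qed
qed

end
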